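(* Let $c\in(0,1]$. As $n\to\infty$ and $p\to c$ (with $p\in(0,1]$), the random variable $X_{n,p}=I(n,p)/(n^2p)$ converges in distribution to a random variable $X_c$ whose distribution is characterized as the unique solution with finite mean of the distributional equation $$X_c\overset{\text{law}}{=}[(1-2c)U+c]^2X_c+[(2c-1)U+1-c]^2\widetilde X_c+T(c,U),$$ in which $U$ is uniformly distributed on $[0,1]$, $\widetilde X_c$ denotes a copy of $X_c$ (i.e. has the same distribution as $X_c$), the random variables $X_c,\widetilde X_c,U$ on the right-hand side are independent, and $$T(c,U)=\frac{1-c}{2}\bigl(U^2+(1-U)^2\bigr)+cU(1-U).$$ Furthermore, $$\mathbb E[X_c]=\frac{2-c}{2(1+2c-2c^2)},\qquad \mathrm{Var}(X_c)=\frac{(1-c)^2(1-2c)^2}{4(1+2c-2c^2)^2(3+6c-8c^2+4c^3-2c^4)}.$$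
   Context: Quicksort with errors: the input is a list of $n$ distinct numbers presented in uniformly random order (each of the $n!$ orders equiprobable). An empty list is returned as is. For a nonempty list, its first element is the pivot, and every other element is compared with the pivot; each comparison gives the wrong answer with probability $p$ (and the right answer with probability $1-p$), independently of all other comparisons, of positions and of values. The elements declared smaller than the pivot form the left sublist, those declared larger form the right sublist (each kept in its original relative order). The same procedure is applied recursively, with independent new errors, to the two sublists, and the output is the concatenation of the output of the left sublist, the pivot, and the output of the right sublist. For a sequence $y=(y_1,\dots,y_n)$ the number of inversions is $I(y)=\#\{(i,j):1\le i<j\le n,\ y_i>y_j\}$. $I(n,p)$ denotes the random number of inversions of the output of Quicksort with errors on an input of length $n$ with error probability $p$. *)

theory Defs
  imports "HOL-Probability.Probability"
begin

text \<open>
  Comparing the elements of a list with the pivot \<open>x\<close>: the answer to ``is \<open>y\<close> smaller than \<open>x\<close>?''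
  is flipped with probability \<open>p\<close>, independently for each \<open>y\<close>.
\<close>
fun err_partition :: "real \<Rightarrow> 'a::linorder \<Rightarrow> 'a list \<Rightarrow> ('a list \<times> 'a list) pmf" where
  "err_partition p x [] = return_pmf ([], [])"
| "err_partition p x (y # ys) =
     do {
       wrong \<leftarrow> bernoulli_pmf p;
       (ls, rs) \<leftarrow> err_partition p x ys;
       return_pmf (if (y < x) \<noteq> wrong then (y # ls, rs) else (ls, y # rs))
     }"

lemma err_partition_length:
  "(ls, rs) \<in> set_pmf (err_partition p x ys) \<Longrightarrow> length ls + length rs = length ys"
  by (induction ys arbitrary: ls rs) (auto split: if_splits)

function err_quicksort :: "real \<Rightarrow> 'a::linorder list \<Rightarrow> 'a list pmf" where
  "err_quicksort p [] = return_pmf []"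
| "err_quicksort p (x # xs) =
     do {
       (ls, rs) \<leftarrow> err_partition p x xs;
       ls' \<leftarrow> err_quicksort p ls;
       rs' \<leftarrow> err_quicksort p rs;
       return_pmf (ls' @ x # rs')
     }"
  by pat_completeness auto
termination
  by (relation "Wellfounded.measure (\<lambda>(p, xs). length xs)") (auto dest!: err_partition_length)

definition inversions :: "'a::linorder list \<Rightarrow> nat" where
  "inversions ys = card {(i, j). i < j \<and> j < length ys \<and> ys ! i > ys ! j}"

definition err_inversions_on :: "'a::linorder set \<Rightarrow> real \<Rightarrow> nat pmf" where
  "err_inversions_on A p =
     do {
       xs \<leftarrow> pmf_of_set (permutations_of_set A);
       ys \<leftarrow> err_quicksort p xs;
       return_pmf (inversions ys)
     }"

text \<open>
  The law of \<open>I(n,p)\<close>, with \<open>1, \<dots>, n\<close> as the distinct numbers to be sorted. By lemma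
  \<open>err_inversions_on_eq\<close> below any other \<open>n\<close> distinct numbers give the same law.
\<close>
definition err_inversions :: "nat \<Rightarrow> real \<Rightarrow> nat pmf" where
  "err_inversions n p = err_inversions_on {1..n} p"

lemma err_partition_map:
  assumes "strict_mono_on (insert x (set ys)) f"
  shows "err_partition p (f x) (map f ys) =
           map_pmf (map_prod (map f) (map f)) (err_partition p x ys)"
  using assms
proof (induction ys)
  case (Cons y ys)
  have "strict_mono_on (insert x (set ys)) f"
    using Cons.prems by (auto simp: strict_mono_on_def)
  note IH = Cons.IH[OF this]
  have less: "f y < f x \<longleftrightarrow> y < x"
    using Cons.prems by (intro strict_mono_on_less) auto
  show ?case
    by (auto simp: IH less map_bind_pmf bind_map_pmf case_prod_unfold intro!: bind_pmf_cong)
qed simp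

lemma mset_err_partition:
  "(ls, rs) \<in> set_pmf (err_partition p x ys) \<Longrightarrow> mset ls + mset rs = mset ys"
  by (induction ys arbitrary: ls rs) (auto split: if_splits)

lemma err_partition_set:
  "(ls, rs) \<in> set_pmf (err_partition p x ys) \<Longrightarrow> set ls \<subseteq> set ys \<and> set rs \<subseteq> set ys"
  using mset_subset_eqD[of "mset ls" "mset ys"] mset_subset_eqD[of "mset rs" "mset ys"]
  by (auto dest!: mset_err_partition simp: subset_iff simp del: set_mset_mset) (metis mset_subset_eq_add_left mset_subset_eq_add_right set_mset_mset)+

lemma err_quicksort_map:
  assumes "strict_mono_on (set xs) f"
  shows "err_quicksort p (map f xs) = map_pmf (map f) (err_quicksort p xs)"
  using assms
proof (induction p xs rule: err_quicksort.induct)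
  case (2 p x xs)
  have IH: "err_quicksort p (map f ls) = map_pmf (map f) (err_quicksort p ls)"
           "err_quicksort p (map f rs) = map_pmf (map f) (err_quicksort p rs)"
    if "(ls, rs) \<in> set_pmf (err_partition p x xs)" for ls rs
  proof -
    have *: "strict_mono_on (set ls) f" "strict_mono_on (set rs) f"
      using "2.prems" err_partition_set[OF that]
      by (auto simp: strict_mono_on_def)
    show "err_quicksort p (map f ls) = map_pmf (map f) (err_quicksort p ls)"
      using "2.IH"(1)[OF that refl *(1)] .
    show "err_quicksort p (map f rs) = map_pmf (map f) (err_quicksort p rs)"
      using "2.IH" that * by (metis set_pmf_not_empty all_not_in_conv)
  qed
  have "err_partition p (f x) (map f xs) =
          map_pmf (map_prod (map f) (map f)) (err_partition p x xs)"
    using "2.prems" by (intro err_partition_map) simp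
  then show ?case
    by (auto simp: map_bind_pmf bind_map_pmf IH intro!: bind_pmf_cong)
qed simp

lemma mset_err_quicksort: "ys \<in> set_pmf (err_quicksort p xs) \<Longrightarrow> mset ys = mset xs"
proof (induction p xs arbitrary: ys rule: err_quicksort.induct)
  case (2 p x xs)
  from "2.prems" obtain ls rs ls' rs' where *:
    "(ls, rs) \<in> set_pmf (err_partition p x xs)" "ls' \<in> set_pmf (err_quicksort p ls)"
    "rs' \<in> set_pmf (err_quicksort p rs)" "ys = ls' @ x # rs'"
    by auto
  from "2.IH"(1)[OF *(1) refl *(2)] "2.IH"(2)[OF *(1) refl *(2) *(3)] show ?case
    using mset_err_partition[OF *(1)] *(4) by simp
qed simp

lemma inversions_map:
  assumes "strict_mono_on (set ys) f"
  shows "inversions (map f ys) = inversions ys"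
proof -
  have "f (ys ! j) < f (ys ! i) \<longleftrightarrow> ys ! j < ys ! i" if "i < length ys" "j < length ys" for i j
    using assms that by (intro strict_mono_on_less) auto
  then show ?thesis
    unfolding inversions_def by (intro arg_cong[where f = card]) auto
qed

lemma err_inversions_on_image:
  assumes "finite A" "strict_mono_on A f"
  shows "err_inversions_on (f ` A) p = err_inversions_on A p"
proof -
  have inj: "inj_on f A"
    using assms(2) by (rule strict_mono_on_imp_inj_on)
  have inj_map: "inj_on (map f) (permutations_of_set A)"
  proof (rule inj_onI)
    fix xs ys assume "xs \<in> permutations_of_set A" "ys \<in> permutations_of_set A" "map f xs = map f ys"
    then show "xs = ys"
      using inj inj_on_map_eq_map[of f xs ys] by (simp add: permutations_of_set_def)
  qed
  have "pmf_of_set (permutations_of_set (f ` A)) =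
          map_pmf (map f) (pmf_of_set (permutations_of_set A))"
    using assms(1) inj inj_map
    by (subst map_pmf_of_set_inj) (auto simp: permutations_of_set_image_inj)
  moreover have "bind_pmf (err_quicksort p (map f xs)) (\<lambda>ys. return_pmf (inversions ys)) =
                 bind_pmf (err_quicksort p xs) (\<lambda>ys. return_pmf (inversions ys))"
    if "xs \<in> permutations_of_set A" for xs
  proof -
    have set: "set xs = A" using that by (simp add: permutations_of_set_def)
    show ?thesis
      using assms(2)
      by (auto simp: err_quicksort_map set bind_map_pmf intro!: bind_pmf_cong inversions_map)
        (metis set mset_err_quicksort mset_eq_setD)
  qed
  ultimately show ?thesis
    using assms(1) unfolding err_inversions_on_def
    by (auto simp: bind_map_pmf intro!: bind_pmf_cong)
qed

lemma err_inversions_on_eq: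
  fixes A :: "'a::linorder set"
  assumes "finite A" "card A = n"
  shows "err_inversions_on A p = err_inversions n p"
proof -
  define f where "f = (\<lambda>i. sorted_list_of_set A ! (i - 1))"
  have len: "length (sorted_list_of_set A) = n" using assms by simp
  have "strict_mono_on {1..n} f"
    unfolding strict_mono_on_def f_def
    using strict_sorted_list_of_set[of A] len by (auto simp: sorted_wrt_iff_nth_less)
  moreover have "f ` {1..n} = A"
  proof -
    have "f ` {1..n} = (\<lambda>i. sorted_list_of_set A ! i) ` {..<n}"
      unfolding f_def by (force simp: image_iff intro: bexI[of _ "Suc _"])
    also have "\<dots> = set (sorted_list_of_set A)"
      using len by (auto simp: set_conv_nth)
    finally show ?thesis using assms by simp
  qed
  ultimately show ?thesis
    unfolding err_inversions_def using err_inversions_on_image[of "{1..n}" f p] by simp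
qed

text \<open>The law of \<open>X\<^bsub>n,p\<^esub>\<close>.\<close>
definition normalized_err_inversions :: "nat \<Rightarrow> real \<Rightarrow> real measure" where
  "normalized_err_inversions n p =
     distr (measure_pmf (err_inversions n p)) borel (\<lambda>i. real i / ((real n)\<^sup>2 * p))"

definition toll :: "real \<Rightarrow> real \<Rightarrow> real" where
  "toll c u = (1 - c) / 2 * (u\<^sup>2 + (1 - u)\<^sup>2) + c * u * (1 - u)"

text \<open>
  The law of the right-hand side of the distributional equation when \<open>X\<close> and its copy have law \<open>\<mu>\<close>;
  taking the three variables to be the coordinates of a product space makes them independent.
\<close>
definition dist_eq_rhs :: "real \<Rightarrow> real measure \<Rightarrow> real measure" where
  "dist_eq_rhs c \<mu> =
     distr (\<mu> \<Otimes>\<^sub>M (\<mu> \<Otimes>\<^sub>M uniform_measure lborel {0..1})) borel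
       (\<lambda>(x, x', u). ((1 - 2 * c) * u + c)\<^sup>2 * x + ((2 * c - 1) * u + 1 - c)\<^sup>2 * x' + toll c u)"

definition finite_mean_solution :: "real \<Rightarrow> real measure \<Rightarrow> bool" where
  "finite_mean_solution c \<mu> \<longleftrightarrow>
     real_distribution \<mu> \<and> integrable \<mu> (\<lambda>x. x) \<and> \<mu> = dist_eq_rhs c \<mu>"

end

theory Submission
  imports Defs "HOL-Real_Asymp.Real_Asymp"
begin

text \<open>
  The proof compares laws by the distance \<open>sup \<bar>char \<mu> t - char \<nu> t\<bar> / \<bar>t\<bar>\<close> over \<open>t \<noteq> 0\<close>, which is finite for
  laws with finite mean. In the distributional equation, given \<open>U = u\<close>, the two copies of \<open>X\<close> are multiplied
  by \<open>v\<^sup>2\<close> and \<open>(1 - v)\<^sup>2\<close>, where \<open>v = share c u\<close> is the limiting fraction of elements left of the pivot. The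
  distance scales linearly, so the right-hand side contracts it by the mean of \<open>v\<^sup>2 + (1 - v)\<^sup>2\<close>, which is at
  most \<open>2 / 3\<close> (\<open>char_dist_eq_rhs_contraction\<close>). This gives uniqueness. It also gives existence: the iterates
  starting from the point mass at 0 have supports in \<open>[0, 1 / (2 * c)]\<close>, hence a weak limit point, and this
  limit point is a fixed point (\<open>finite_mean_solution_exists\<close>). Its moments are finite, and the equation
  determines the first two of them.

  For the convergence, attach an independent coin to every element other than the pivot. Given the pivot
  and the coins, the two sublists are independent uniformly random permutations
  (\<open>err_inversions_on_rec\<close>). Therefore the characteristic function of the number of inversions satisfies a
  recursion of the same form as the fixed point equation, in which the relative sizes of the sublists and the
  normalized number of inversions created at this level play the roles of \<open>v\<close>, \<open>1 - v\<close> and the toll. All three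
  are functions of the coins with bounded differences, so by a variance bound (\<open>coins_variance_le\<close>) they are
  close to their limits in mean, with an error of order \<open>1 / sqrt n + \<bar>p - c\<bar>\<close>. The average over the rank of the
  pivot is a Riemann sum for the integral over \<open>U\<close>.

  So the distance between the laws of \<open>X\<^bsub>n,p\<^esub>\<close> and of the fixed point is, up to a small error, at most the
  mean of the distances for the two sublist sizes, weighted with the squares of the relative sizes
  (\<open>one_step\<close>). The same contraction, now in an induction on \<open>n\<close>, shows that it is at most \<open>4 * \<eta> + C * M / n\<close>
  for arbitrarily small \<open>\<eta>\<close>, a constant \<open>C\<close> and some \<open>M\<close> depending on \<open>\<eta>\<close> (\<open>err_char_approx\<close>). Levy's continuity
  theorem turns the convergence of characteristic functions into weak convergence.
\<close>

section \<open>The uniform law on the unit interval\<close>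

abbreviation unif :: "real measure" where
  "unif \<equiv> uniform_measure lborel {0..1}"

lemma prob_space_unif: "prob_space unif"
  by (rule prob_space_uniform_measure) simp_all

lemma integral_unif:
  fixes f :: "real \<Rightarrow> 'b::euclidean_space"
  assumes "continuous_on UNIV f"
  shows "integral\<^sup>L unif f = integral {0..1} f"
proof -
  have [measurable]: "f \<in> borel_measurable borel"
    using assms by (rule borel_measurable_continuous_onI)
  have cont: "continuous_on {0..1} f" using assms by (rule continuous_on_subset) simp
  have "unif = density lborel (\<lambda>x. ennreal (indicat_real {0..1} x))"
    unfolding uniform_measure_def by (intro arg_cong[where f = "density lborel"]) (auto simp: indicator_def)
  then have "integral\<^sup>L unif f = (\<integral>x. indicat_real {0..1} x *\<^sub>R f x \<partial>lborel)"
    by (simp add: integral_density)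
  also have "\<dots> = integral {0..1} f"
    using set_borel_integral_eq_integral(2)[OF borel_integrable_atLeastAtMost'[OF cont]]
    by (simp add: set_lebesgue_integral_def)
  finally show ?thesis .
qed

lemma AE_unif: "AE u in unif. 0 \<le> u \<and> u \<le> 1"
  by (rule AE_uniform_measureI) auto

lemma integrable_unif_bounded:
  fixes f :: "real \<Rightarrow> 'b::{banach, second_countable_topology}"
  assumes "f \<in> borel_measurable borel" "\<And>u. 0 \<le> u \<Longrightarrow> u \<le> 1 \<Longrightarrow> norm (f u) \<le> B"
  shows "integrable unif f"
proof -
  interpret prob_space unif by (rule prob_space_unif)
  show ?thesis
  proof (rule integrable_const_bound)
    show "AE u in unif. norm (f u) \<le> B"
      using AE_unif by eventually_elim (use assms(2) in auto)
  qed (use assms(1) in simp)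
qed

lemma integral_unif_quartic:
  "(\<integral>u. a0 + a1 * u + a2 * u ^ 2 + a3 * u ^ 3 + a4 * u ^ 4 \<partial>unif) =
     a0 + a1 / 2 + a2 / 3 + a3 / 4 + a4 / 5"
proof -
  define F where "F = (\<lambda>u::real. a0 * u + a1 * u ^ 2 / 2 + a2 * u ^ 3 / 3 + a3 * u ^ 4 / 4 + a4 * u ^ 5 / 5)"
  have "((\<lambda>u. a0 + a1 * u + a2 * u ^ 2 + a3 * u ^ 3 + a4 * u ^ 4) has_integral (F 1 - F 0)) {0..1}"
  proof (intro fundamental_theorem_of_calculus has_real_derivative_iff_has_vector_derivative[THEN iffD1])
    show "(F has_real_derivative a0 + a1 * u + a2 * u ^ 2 + a3 * u ^ 3 + a4 * u ^ 4) (at u within {0..1})" for u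
      unfolding F_def by (rule derivative_eq_intros refl | simp)+
  qed simp
  then show ?thesis
    by (subst integral_unif) (auto intro!: continuous_intros simp: F_def integral_unique)
qed

text \<open>
  The squared shares and the toll are polynomials in \<open>u * (1 - u)\<close>, so the first two moments of the
  right-hand side of the distributional equation reduce to this integral.
\<close>

lemma integral_unif_quadratic:
  "(\<integral>u. a + b * (u * (1 - u)) + k * (u * (1 - u))\<^sup>2 \<partial>unif) = a + b / 6 + k / 30"
proof -
  have "a + b * (u * (1 - u)) + k * (u * (1 - u))\<^sup>2 = a + b * u + (k - b) * u ^ 2 + (- 2 * k) * u ^ 3 + k * u ^ 4"
    for u :: real
    by (simp add: power2_eq_square power3_eq_cube power4_eq_xxxx algebra_simps)
  then show ?thesis
    by (simp only: integral_unif_quartic) (simp add: field_simps)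
qed

section \<open>Share of the left sublist and toll\<close>

text \<open>
  The limiting fraction of the elements that end up left of a pivot of relative rank \<open>u\<close>: the
  correctly placed \<open>(1 - c) * u\<close> smaller ones and the misplaced \<open>c * (1 - u)\<close> larger ones.
\<close>

definition share :: "real \<Rightarrow> real \<Rightarrow> real" where
  "share c u = (1 - 2 * c) * u + c"

lemma share_bounds:
  assumes "0 \<le> c" "c \<le> 1" "0 \<le> u" "u \<le> 1"
  shows "0 \<le> share c u" "share c u \<le> 1"
proof -
  have eq: "share c u = u * (1 - c) + (1 - u) * c" by (simp add: share_def algebra_simps)
  show "0 \<le> share c u" using assms by (simp add: eq)
  have "1 - share c u = u * c + (1 - u) * (1 - c)" by (simp add: share_def algebra_simps)
  also have "\<dots> \<ge> 0" using assms by simp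
  finally show "share c u \<le> 1" by simp
qed

lemma continuous_share [continuous_intros]:
  "continuous_on S f \<Longrightarrow> continuous_on S (\<lambda>x. share c (f x))"
  unfolding share_def by (intro continuous_intros)

lemma measurable_share [measurable]: "share c \<in> borel_measurable borel"
  unfolding share_def by measurable

lemma toll_nonneg:
  assumes "0 \<le> c" "c \<le> 1" "0 \<le> u" "u \<le> 1"
  shows "0 \<le> toll c u"
  using assms by (simp add: toll_def)

lemma continuous_toll [continuous_intros]:
  "continuous_on S f \<Longrightarrow> continuous_on S (\<lambda>x. toll c (f x))"
  unfolding toll_def by (intro continuous_intros) 

lemma measurable_toll [measurable]: "toll c \<in> borel_measurable borel"
  unfolding toll_def by measurable

lemma share_prod_eq: "share c u * (1 - share c u) = c * (1 - c) + (1 - 2 * c)\<^sup>2 * (u * (1 - u))"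
  by (simp add: share_def power2_eq_square algebra_simps)

lemma toll_eq: "toll c u = (1 - c) / 2 - (1 - 2 * c) * (u * (1 - u))"
  by (simp add: toll_def power2_eq_square field_simps)

text \<open>
  This bound makes \<open>[0, 1 / (2 * c)]\<close> invariant under the distributional equation: for \<open>v = share c u\<close>
  one has \<open>v\<^sup>2 + (1 - v)\<^sup>2 = 1 - 2 * v * (1 - v)\<close>, so if both copies are at most \<open>1 / (2 * c)\<close>, they leave
  room for a toll of exactly \<open>v * (1 - v) / c\<close>.
\<close>

lemma toll_le:
  assumes "0 < c" "c \<le> 1" "0 \<le> u" "u \<le> 1"
  shows "toll c u \<le> share c u * (1 - share c u) / c"
proof -
  have *: "u * (1 - u) \<le> 1 / 4"
    using sum_squares_ge_zero[of "u - 1/2" 0] by (simp add: algebra_simps)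
  have "2 * (u * (1 - u)) * (1 - 2 * c) \<ge> - c"
  proof (cases "c \<le> 1 / 2")
    case True
    then have "0 \<le> 2 * (u * (1 - u)) * (1 - 2 * c)"
      using assms by (intro mult_nonneg_nonneg) auto
    then show ?thesis using assms by linarith
  next
    case False
    have "2 * (u * (1 - u)) * (2 * c - 1) \<le> 1 / 2 * (2 * c - 1)"
      using False * assms by (intro mult_right_mono) auto
    also have "\<dots> \<le> c" by simp
    finally show ?thesis by (simp add: algebra_simps)
  qed
  \<comment> \<open>Twice the difference of the two sides, multiplied by \<open>c\<close>.\<close>
  then have "0 \<le> (1 - c) * (2 * (u * (1 - u)) * (1 - 2 * c) + c)"
    using assms by (intro mult_nonneg_nonneg) auto
  also have "\<dots> = 2 * (share c u * (1 - share c u) - c * toll c u)"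
    by (simp add: share_def toll_def power2_eq_square field_simps)
  finally show ?thesis
    using assms by (simp add: field_simps)
qed

lemma integral_unif_squares:
  "(\<integral>u. (share c u)\<^sup>2 + (1 - share c u)\<^sup>2 \<partial>unif) = 1 / 2 + (1 - 2 * c)\<^sup>2 / 6"
proof -
  have "(share c u)\<^sup>2 + (1 - share c u)\<^sup>2 =
      (c\<^sup>2 + (1 - c)\<^sup>2) + (- 2 * (1 - 2 * c)\<^sup>2) * u + (2 * (1 - 2 * c)\<^sup>2) * u ^ 2 + 0 * u ^ 3 + 0 * u ^ 4" for u
    by (simp add: share_def power2_eq_square algebra_simps)
  then show ?thesis
    by (simp only: integral_unif_quartic) (simp add: power2_eq_square field_simps)
qed

text \<open>
  The contraction factor. The share is uniformly distributed between \<open>c\<close> and \<open>1 - c\<close>, and even in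
  the extreme case \<open>c = 1\<close> the squares of a uniform variable and of its complement have total mean
  \<open>2 / 3\<close>.
\<close>

lemma integral_unif_squares_le:
  assumes "0 \<le> c" "c \<le> 1"
  shows "(\<integral>u. (share c u)\<^sup>2 + (1 - share c u)\<^sup>2 \<partial>unif) \<le> 2 / 3"
proof -
  have "(1 - 2 * c)\<^sup>2 \<le> 1"
    using assms by (simp add: abs_square_le_1 abs_le_iff)
  then show ?thesis by (simp add: integral_unif_squares)
qed

lemma integrable_unif_squares:
  assumes "0 \<le> c" "c \<le> 1"
  shows "integrable unif (\<lambda>u. (share c u)\<^sup>2 + (1 - share c u)\<^sup>2)"
proof (rule integrable_unif_bounded)
  show "norm ((share c u)\<^sup>2 + (1 - share c u)\<^sup>2) \<le> 2" if "0 \<le> u" "u \<le> 1" for u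
  proof -
    have "(share c u)\<^sup>2 \<le> 1" "(1 - share c u)\<^sup>2 \<le> 1"
      using share_bounds[OF assms that] by (auto intro!: power_le_one)
    then show ?thesis by simp
  qed
qed measurable

lemma share_lipschitz:
  assumes "0 \<le> c" "c \<le> 1"
  shows "\<bar>share c v - share c u\<bar> \<le> \<bar>v - u\<bar>"
proof -
  have eq: "share c v - share c u = (1 - 2 * c) * (v - u)"
    by (simp add: share_def algebra_simps)
  have "\<bar>1 - 2 * c\<bar> * \<bar>v - u\<bar> \<le> 1 * \<bar>v - u\<bar>"
    using assms by (intro mult_right_mono) auto
  then show ?thesis by (simp add: eq abs_mult)
qed

lemma toll_lipschitz:
  assumes "0 \<le> c" "c \<le> 1" "0 \<le> u" "u \<le> 1" "0 \<le> v" "v \<le> 1"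
  shows "\<bar>toll c v - toll c u\<bar> \<le> \<bar>v - u\<bar>"
proof -
  have eq: "toll c v - toll c u = (1 - 2 * c) * (u + v - 1) * (v - u)"
    by (simp add: toll_eq algebra_simps)
  have "\<bar>1 - 2 * c\<bar> * \<bar>u + v - 1\<bar> * \<bar>v - u\<bar> \<le> 1 * 1 * \<bar>v - u\<bar>"
    using assms by (intro mult_right_mono mult_mono) auto
  then show ?thesis by (simp add: eq abs_mult)
qed

lemma abs_square_diff_le:
  assumes "0 \<le> a" "a \<le> 1" "0 \<le> b" "b \<le> (1::real)"
  shows "\<bar>a\<^sup>2 - b\<^sup>2\<bar> \<le> 2 * \<bar>a - b\<bar>"
proof -
  have eq: "a\<^sup>2 - b\<^sup>2 = (a + b) * (a - b)" by (simp add: power2_eq_square algebra_simps)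
  have "\<bar>a + b\<bar> * \<bar>a - b\<bar> \<le> 2 * \<bar>a - b\<bar>"
    using assms by (intro mult_right_mono) auto
  then show ?thesis by (simp add: eq abs_mult)
qed

lemma share_diff_le:
  assumes "0 \<le> u" "u \<le> 1"
  shows "\<bar>share p u - share c u\<bar> \<le> \<bar>p - c\<bar>"
proof -
  have eq: "share p u - share c u = (p - c) * (1 - 2 * u)"
    by (simp add: share_def algebra_simps)
  have "\<bar>p - c\<bar> * \<bar>1 - 2 * u\<bar> \<le> \<bar>p - c\<bar> * 1"
    using assms by (intro mult_left_mono) auto
  then show ?thesis by (simp add: eq abs_mult)
qed

lemma toll_diff_le:
  assumes "0 \<le> u" "u \<le> 1"
  shows "\<bar>toll p u - toll c u\<bar> \<le> \<bar>p - c\<bar>"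
proof -
  have eq: "toll p u - toll c u = (p - c) * (2 * (u * (1 - u)) - 1 / 2)"
    by (simp add: toll_eq field_simps)
  have "0 \<le> u * (1 - u)" using assms by simp
  moreover have "u * (1 - u) \<le> 1 / 4"
    using sum_squares_ge_zero[of "u - 1/2" 0] by (simp add: algebra_simps)
  ultimately have "\<bar>p - c\<bar> * \<bar>2 * (u * (1 - u)) - 1 / 2\<bar> \<le> \<bar>p - c\<bar> * 1"
    by (intro mult_left_mono) auto
  then show ?thesis by (simp add: eq abs_mult)
qed

section \<open>The distributional equation for characteristic functions\<close>

definition rhs_map :: "real \<Rightarrow> real \<times> real \<times> real \<Rightarrow> real" where
  "rhs_map c = (\<lambda>(x, x', u). (share c u)\<^sup>2 * x + (1 - share c u)\<^sup>2 * x' + toll c u)"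

lemma measurable_rhs_map [measurable]:
  "rhs_map c \<in> borel_measurable (borel \<Otimes>\<^sub>M (borel \<Otimes>\<^sub>M borel))"
  unfolding rhs_map_def by measurable

lemma dist_eq_rhs_alt:
  "dist_eq_rhs c \<mu> = distr (\<mu> \<Otimes>\<^sub>M (\<mu> \<Otimes>\<^sub>M unif)) borel (rhs_map c)"
proof -
  have "(2 * c - 1) * u + 1 - c = 1 - share c u" for u
    by (simp add: share_def algebra_simps)
  then show ?thesis
    unfolding dist_eq_rhs_def rhs_map_def by (simp only: share_def)
qed

lemma measurable_rhs_map_triple [measurable]:
  assumes "real_distribution \<mu>"
  shows "rhs_map c \<in> borel_measurable (\<mu> \<Otimes>\<^sub>M (\<mu> \<Otimes>\<^sub>M unif))"
proof -
  interpret real_distribution \<mu> by fact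
  show ?thesis by measurable
qed

lemma prob_space_triple:
  assumes "real_distribution \<mu>"
  shows "prob_space (\<mu> \<Otimes>\<^sub>M unif)" "prob_space (\<mu> \<Otimes>\<^sub>M (\<mu> \<Otimes>\<^sub>M unif))"
proof -
  interpret real_distribution \<mu> by fact
  interpret U: prob_space unif by (rule prob_space_unif)
  interpret P: pair_prob_space \<mu> unif ..
  show "prob_space (\<mu> \<Otimes>\<^sub>M unif)" by (rule P.prob_space_axioms)
  interpret Q: pair_prob_space \<mu> "\<mu> \<Otimes>\<^sub>M unif" ..
  show "prob_space (\<mu> \<Otimes>\<^sub>M (\<mu> \<Otimes>\<^sub>M unif))" by (rule Q.prob_space_axioms)
qed

lemma real_distribution_dist_eq_rhs:
  assumes "real_distribution \<mu>"
  shows "real_distribution (dist_eq_rhs c \<mu>)"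
proof -
  interpret prob_space "\<mu> \<Otimes>\<^sub>M (\<mu> \<Otimes>\<^sub>M unif)" by (rule prob_space_triple[OF assms])
  show ?thesis
    unfolding dist_eq_rhs_alt by (intro real_distribution_distr measurable_rhs_map_triple assms)
qed

text \<open>
  Fubini with the uniform variable outermost: once \<open>u\<close> is fixed, the two copies enter linearly with
  fixed coefficients.
\<close>

lemma integral_dist_eq_rhs:
  fixes f :: "real \<Rightarrow> 'b::{banach, second_countable_topology}"
  assumes "real_distribution \<mu>" and f: "integrable (dist_eq_rhs c \<mu>) f"
  shows "integral\<^sup>L (dist_eq_rhs c \<mu>) f =
           (\<integral>u. \<integral>x'. \<integral>x. f ((share c u)\<^sup>2 * x + (1 - share c u)\<^sup>2 * x' + toll c u) \<partial>\<mu> \<partial>\<mu> \<partial>unif)"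
proof -
  interpret real_distribution \<mu> by fact
  interpret U: prob_space unif by (rule prob_space_unif)
  interpret P: pair_prob_space \<mu> unif ..
  interpret Q: pair_prob_space \<mu> "\<mu> \<Otimes>\<^sub>M unif" ..
  have [measurable]: "f \<in> borel_measurable borel"
    using f by (auto simp: dist_eq_rhs_alt)
  let ?g = "\<lambda>z. f (rhs_map c z)"
  have int: "integrable (\<mu> \<Otimes>\<^sub>M (\<mu> \<Otimes>\<^sub>M unif)) ?g"
    using f unfolding dist_eq_rhs_alt by (subst (asm) integrable_distr_eq) auto
  have eq: "integral\<^sup>L (dist_eq_rhs c \<mu>) f = integral\<^sup>L (\<mu> \<Otimes>\<^sub>M (\<mu> \<Otimes>\<^sub>M unif)) ?g"
    unfolding dist_eq_rhs_alt by (subst integral_distr) auto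
  have "\<dots> = (\<integral>z. \<integral>x. ?g (x, z) \<partial>\<mu> \<partial>(\<mu> \<Otimes>\<^sub>M unif))"
    using Q.integral_snd[of "\<lambda>x z. ?g (x, z)"] int by (simp add: split_beta')
  also have "\<dots> = (\<integral>u. \<integral>x'. \<integral>x. ?g (x, x', u) \<partial>\<mu> \<partial>\<mu> \<partial>unif)"
  proof -
    have "integrable (\<mu> \<Otimes>\<^sub>M unif) (\<lambda>z. \<integral>x. ?g (x, z) \<partial>\<mu>)"
      using Q.integrable_snd[of "\<lambda>x z. ?g (x, z)"] int by (simp add: split_beta')
    then show ?thesis
      using P.integral_snd[of "\<lambda>x' u. \<integral>x. ?g (x, x', u) \<partial>\<mu>"] by (simp add: split_beta')
  qed
  finally show ?thesis using eq by (simp add: rhs_map_def)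
qed

text \<open>
  For a fixed \<open>u\<close> the exponential splits into a product over the two independent copies.
\<close>

lemma char_dist_eq_rhs:
  assumes "real_distribution \<mu>"
  shows "char (dist_eq_rhs c \<mu>) t =
           (\<integral>u. iexp (t * toll c u) * char \<mu> (t * (share c u)\<^sup>2) * char \<mu> (t * (1 - share c u)\<^sup>2) \<partial>unif)"
proof -
  interpret real_distribution \<mu> by fact
  interpret R: real_distribution "dist_eq_rhs c \<mu>" by (rule real_distribution_dist_eq_rhs) fact
  have "char (dist_eq_rhs c \<mu>) t = 
    (\<integral>u. \<integral>x'. \<integral>x. iexp (t * ((share c u)\<^sup>2 * x + (1 - share c u)\<^sup>2 * x' + toll c u)) \<partial>\<mu> \<partial>\<mu> \<partial>unif)"
    unfolding char_def
    by (rule integral_dist_eq_rhs[OF assms]) (auto intro!: R.integrable_iexp)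
  also have "\<dots> = (\<integral>u. \<integral>x'. \<integral>x. iexp (t * toll c u) * iexp (t * (1 - share c u)\<^sup>2 * x') * iexp (t * (share c u)\<^sup>2 * x) \<partial>\<mu> \<partial>\<mu> \<partial>unif)"
    by (simp add: algebra_simps flip: exp_add)
  also have "\<dots> = (\<integral>u. iexp (t * toll c u) * char \<mu> (t * (share c u)\<^sup>2) * char \<mu> (t * (1 - share c u)\<^sup>2) \<partial>unif)"
    unfolding char_def by (simp add: mult_ac flip: of_real_mult)
  finally show ?thesis .
qed

lemma measurable_char_dist_eq_rhs_integrand:
  assumes "real_distribution \<mu>"
  shows "(\<lambda>u. iexp (t * toll c u) * char \<mu> (t * (share c u)\<^sup>2) * char \<mu> (t * (1 - share c u)\<^sup>2))
           \<in> borel_measurable borel"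
proof -
  interpret real_distribution \<mu> by fact
  show ?thesis by measurable
qed

lemma integrable_char_dist_eq_rhs_integrand:
  assumes "real_distribution \<mu>"
  shows "integrable unif
    (\<lambda>u. iexp (t * toll c u) * char \<mu> (t * (share c u)\<^sup>2) * char \<mu> (t * (1 - share c u)\<^sup>2))"
proof -
  interpret real_distribution \<mu> by fact
  show ?thesis
    by (intro integrable_unif_bounded[of _ 1] measurable_char_dist_eq_rhs_integrand assms)
      (auto simp: norm_mult intro!: mult_le_one cmod_char_le_1)
qed

section \<open>Contraction and uniqueness\<close>

lemma norm_mult_diff_le:
  fixes a b a' b' :: complex
  assumes "norm a \<le> 1" "norm b' \<le> 1"
  shows "norm (a * b - a' * b') \<le> norm (a - a') + norm (b - b')"
proof -
  have "a * b - a' * b' = a * (b - b') + (a - a') * b'" by (simp add: algebra_simps)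
  also have "norm \<dots> \<le> norm a * norm (b - b') + norm (a - a') * norm b'"
    by (metis norm_mult norm_triangle_ineq)
  also have "\<dots> \<le> 1 * norm (b - b') + norm (a - a') * 1"
    using assms by (intro add_mono mult_mono) auto
  finally show ?thesis by simp
qed

lemma norm_mult3_diff_le:
  fixes a b c a' b' c' :: complex
  assumes "norm a \<le> 1" "norm b \<le> 1" "norm b' \<le> 1" "norm c' \<le> 1"
  shows "norm (a * b * c - a' * b' * c') \<le> norm (a - a') + norm (b - b') + norm (c - c')"
proof -
  have "norm (a * b * c - a' * b' * c') \<le> norm (a * b - a' * b') + norm (c - c')"
    using assms by (intro norm_mult_diff_le) (auto simp: norm_mult mult_le_one)
  also have "norm (a * b - a' * b') \<le> norm (a - a') + norm (b - b')"
    using assms by (intro norm_mult_diff_le) auto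
  finally show ?thesis by simp
qed

text \<open>
  The length of a chord of the unit circle is at most the length of the arc.
\<close>

lemma norm_iexp_diff_le: "norm (iexp x - iexp y) \<le> \<bar>x - y\<bar>"
proof -
  have "iexp x - iexp y = iexp y * (iexp (x - y) - 1)"
    by (simp add: exp_diff algebra_simps)
  also have "norm \<dots> = norm (iexp (x - y) - 1)"
    by (simp add: norm_mult)
  also have "\<dots> \<le> \<bar>x - y\<bar>"
    using iexp_approx1[of "x - y" 0] by simp
  finally show ?thesis .
qed

lemma (in real_distribution) norm_char_diff_le:
  assumes "integrable M (\<lambda>x. x)"
  shows "norm (char M s - char M t) \<le> \<bar>s - t\<bar> * expectation (\<lambda>x. \<bar>x\<bar>)"
proof -
  have "char M s - char M t = (CLINT x|M. iexp (s * x) - iexp (t * x))"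
    unfolding char_def by (subst Bochner_Integration.integral_diff) (auto intro!: integrable_iexp)
  also have "norm \<dots> \<le> (\<integral>x. norm (iexp (s * x) - iexp (t * x)) \<partial>M)"
    by (rule integral_norm_bound)
  also have "\<dots> \<le> (\<integral>x. \<bar>s - t\<bar> * \<bar>x\<bar> \<partial>M)"
  proof (intro integral_mono)
    show "integrable M (\<lambda>x. norm (iexp (s * x) - iexp (t * x)))"
      by (intro integrable_norm Bochner_Integration.integrable_diff integrable_iexp) auto
    show "integrable M (\<lambda>x. \<bar>s - t\<bar> * \<bar>x\<bar>)"
      using assms by (intro integrable_mult_right integrable_abs)
    show "norm (iexp (s * x) - iexp (t * x)) \<le> \<bar>s - t\<bar> * \<bar>x\<bar>" for x
      using norm_iexp_diff_le[of "s * x" "t * x"] by (simp add: abs_mult flip: left_diff_distrib)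
  qed
  also have "\<dots> = \<bar>s - t\<bar> * expectation (\<lambda>x. \<bar>x\<bar>)" by simp
  finally show ?thesis .
qed

lemma (in real_distribution) norm_char_minus_1_le:
  assumes "integrable M (\<lambda>x. x)"
  shows "norm (char M t - 1) \<le> \<bar>t\<bar> * expectation (\<lambda>x. \<bar>x\<bar>)"
  using norm_char_diff_le[OF assms, of t 0] by (simp add: char_zero)

text \<open>
  The distance \<open>sup \<bar>char \<mu> t - char \<nu> t\<bar> / \<bar>t\<bar>\<close> is homogeneous under scaling: evaluating at
  \<open>t * (share c u)\<^sup>2\<close> instead of \<open>t\<close> gains the factor \<open>(share c u)\<^sup>2\<close>. As the factors of the integrand
  have modulus at most 1, the errors of the two copies add up, and the mean of the two coefficients is at
  most \<open>2 / 3\<close>.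
\<close>

lemma char_dist_eq_rhs_contraction:
  assumes "real_distribution \<mu>" "real_distribution \<nu>" "0 \<le> c" "c \<le> 1"
    and "\<And>t. norm (char \<mu> t - char \<nu> t) \<le> K * \<bar>t\<bar>"
  shows "norm (char (dist_eq_rhs c \<mu>) t - char (dist_eq_rhs c \<nu>) t) \<le> 2 / 3 * K * \<bar>t\<bar>"
proof -
  interpret M: real_distribution \<mu> by fact
  interpret N: real_distribution \<nu> by fact
  have K: "0 \<le> K"
    using assms(5)[of 1] norm_ge_zero[of "char \<mu> 1 - char \<nu> 1"] by linarith
  let ?f = "\<lambda>\<mu> u. iexp (t * toll c u) * char \<mu> (t * (share c u)\<^sup>2) * char \<mu> (t * (1 - share c u)\<^sup>2)"
  note int = integrable_char_dist_eq_rhs_integrand[OF assms(1), of t c]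
    integrable_char_dist_eq_rhs_integrand[OF assms(2), of t c]
  let ?g = "\<lambda>u. K * \<bar>t\<bar> * ((share c u)\<^sup>2 + (1 - share c u)\<^sup>2)"
  have pointwise: "norm (?f \<mu> u - ?f \<nu> u) \<le> ?g u" for u
  proof -
    have "norm (?f \<mu> u - ?f \<nu> u) \<le> norm (iexp (t * toll c u) - iexp (t * toll c u)) +
       norm (char \<mu> (t * (share c u)\<^sup>2) - char \<nu> (t * (share c u)\<^sup>2)) +
       norm (char \<mu> (t * (1 - share c u)\<^sup>2) - char \<nu> (t * (1 - share c u)\<^sup>2))"
      by (intro norm_mult3_diff_le M.cmod_char_le_1 N.cmod_char_le_1) simp
    also have "\<dots> \<le> 0 + K * \<bar>t * (share c u)\<^sup>2\<bar> + K * \<bar>t * (1 - share c u)\<^sup>2\<bar>"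
      by (intro add_mono assms(5)) simp
    finally show ?thesis by (simp add: abs_mult algebra_simps)
  qed
  have int_diff: "integrable unif (\<lambda>u. ?f \<mu> u - ?f \<nu> u)"
    by (rule Bochner_Integration.integrable_diff) (rule int)+
  have diff: "char (dist_eq_rhs c \<mu>) t - char (dist_eq_rhs c \<nu>) t = (\<integral>u. ?f \<mu> u - ?f \<nu> u \<partial>unif)"
    unfolding char_dist_eq_rhs[OF assms(1)] char_dist_eq_rhs[OF assms(2)]
    by (rule Bochner_Integration.integral_diff[symmetric]) (rule int)+
  have int_g: "integrable unif ?g"
    by (rule integrable_mult_right) (rule integrable_unif_squares[OF assms(3,4)])
  have "norm (char (dist_eq_rhs c \<mu>) t - char (dist_eq_rhs c \<nu>) t) \<le> (\<integral>u. norm (?f \<mu> u - ?f \<nu> u) \<partial>unif)"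
    unfolding diff by (rule integral_norm_bound)
  also have "\<dots> \<le> integral\<^sup>L unif ?g"
    using integrable_norm[OF int_diff] int_g pointwise by (rule integral_mono)
  also have "\<dots> = K * \<bar>t\<bar> * (\<integral>u. (share c u)\<^sup>2 + (1 - share c u)\<^sup>2 \<partial>unif)"
    by simp
  also have "\<dots> \<le> K * \<bar>t\<bar> * (2 / 3)"
    using K assms by (intro mult_left_mono integral_unif_squares_le) auto
  finally show ?thesis by (simp add: mult_ac)
qed

text \<open>
  Finite means make the distance between two solutions finite. It is at most \<open>2 / 3\<close> of itself,
  hence zero, and a law is determined by its characteristic function.
\<close>

lemma finite_mean_solution_unique:
  assumes c: "0 \<le> c" "c \<le> 1" and "finite_mean_solution c \<mu>" "finite_mean_solution c \<nu>"
  shows "\<mu> = \<nu>"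
proof -
  interpret M: real_distribution \<mu> using assms(3) by (simp add: finite_mean_solution_def)
  interpret N: real_distribution \<nu> using assms(4) by (simp add: finite_mean_solution_def)
  note rd = M.real_distribution_axioms N.real_distribution_axioms
  have int: "integrable \<mu> (\<lambda>x. x)" "integrable \<nu> (\<lambda>x. x)"
    and fix_eq: "dist_eq_rhs c \<mu> = \<mu>" "dist_eq_rhs c \<nu> = \<nu>"
    using assms(3,4) by (simp_all add: finite_mean_solution_def)
  define K where "K = M.expectation (\<lambda>x. \<bar>x\<bar>) + N.expectation (\<lambda>x. \<bar>x\<bar>)"
  \<comment> \<open>Iterating the contraction avoids the supremum in the distance.\<close>
  have bound: "norm (char \<mu> t - char \<nu> t) \<le> K * (2 / 3) ^ k * \<bar>t\<bar>" for k t
  proof (induction k arbitrary: t)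
    case 0
    have "norm (char \<mu> t - char \<nu> t) \<le> norm (char \<mu> t - 1) + norm (char \<nu> t - 1)"
      by (metis norm_triangle_ineq4 diff_diff_eq2 diff_add_cancel)
    also have "\<dots> \<le> K * \<bar>t\<bar>"
      using M.norm_char_minus_1_le[OF int(1), of t] N.norm_char_minus_1_le[OF int(2), of t]
      by (simp add: K_def algebra_simps)
    finally show ?case by simp
  next
    case (Suc k)
    show ?case
      using char_dist_eq_rhs_contraction[OF rd c Suc.IH, of t] by (simp add: fix_eq mult_ac)
  qed
  have "char \<mu> t = char \<nu> t" for t
  proof -
    have "(\<lambda>k. K * (2 / 3) ^ k * \<bar>t\<bar>) \<longlonglongrightarrow> K * 0 * \<bar>t\<bar>"
      by (intro tendsto_intros LIMSEQ_realpow_zero) auto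
    then have "norm (char \<mu> t - char \<nu> t) \<le> K * 0 * \<bar>t\<bar>"
      using bound by (intro LIMSEQ_le_const) auto
    then show ?thesis by simp
  qed
  then show ?thesis
    using Levy_uniqueness[OF rd] by blast
qed

section \<open>Existence of a solution with bounded support\<close>

lemma dist_eq_rhs_support:
  assumes "real_distribution \<mu>" "0 < c" "c \<le> 1" and "AE x in \<mu>. 0 \<le> x \<and> x \<le> 1 / (2 * c)"
  shows "AE x in dist_eq_rhs c \<mu>. 0 \<le> x \<and> x \<le> 1 / (2 * c)"
proof -
  interpret real_distribution \<mu> by fact
  interpret U: prob_space unif by (rule prob_space_unif)
  interpret P: pair_prob_space \<mu> unif ..
  interpret Q: pair_prob_space \<mu> "\<mu> \<Otimes>\<^sub>M unif" ..
  let ?B = "\<lambda>x. 0 \<le> x \<and> x \<le> 1 / (2 * c)"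
  have *: "?B (rhs_map c (x, x', u))" if "?B x" "?B x'" "0 \<le> u \<and> u \<le> 1" for x x' u
  proof
    define v where "v = share c u"
    have v: "0 \<le> v" "v \<le> 1" using share_bounds[of c u] that assms by (auto simp: v_def)
    show "0 \<le> rhs_map c (x, x', u)"
      using that assms by (auto simp: rhs_map_def intro!: add_nonneg_nonneg mult_nonneg_nonneg toll_nonneg)
    have "rhs_map c (x, x', u) \<le> v\<^sup>2 * (1 / (2 * c)) + (1 - v)\<^sup>2 * (1 / (2 * c)) + v * (1 - v) / c"
      unfolding rhs_map_def v_def prod.case using that assms(2,3)
      by (intro add_mono mult_left_mono toll_le) auto
    also have "\<dots> = 1 / (2 * c)"
      using assms by (simp add: power2_eq_square field_simps)
    finally show "rhs_map c (x, x', u) \<le> 1 / (2 * c)" .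
  qed
  have "AE z in \<mu> \<Otimes>\<^sub>M unif. ?B (fst z) \<and> 0 \<le> snd z \<and> snd z \<le> 1"
    by (rule P.AE_pair_measure, measurable) (use assms(4) AE_unif in auto)
  then have "AE w in \<mu> \<Otimes>\<^sub>M (\<mu> \<Otimes>\<^sub>M unif). ?B (fst w) \<and> ?B (fst (snd w)) \<and> 0 \<le> snd (snd w) \<and> snd (snd w) \<le> 1"
    by (intro Q.AE_pair_measure, measurable) (use assms(4) in auto)
  then have "AE w in \<mu> \<Otimes>\<^sub>M (\<mu> \<Otimes>\<^sub>M unif). ?B (rhs_map c w)"
    by eventually_elim (use * in auto)
  then show ?thesis
    unfolding dist_eq_rhs_alt by (subst AE_distr_iff) (auto intro: measurable_rhs_map_triple assms)
qed

lemma (in real_distribution) integrable_bounded_support: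
  assumes "AE x in M. 0 \<le> x \<and> x \<le> b"
  shows "integrable M (\<lambda>x. x ^ k)"
proof (rule integrable_const_bound)
  show "AE x in M. norm (x ^ k) \<le> b ^ k"
    using assms by eventually_elim (auto simp: power_abs intro: power_mono)
qed simp

text \<open>
  The truncated distance to the interval is a bounded continuous test function that vanishes
  exactly on the interval.
\<close>

lemma weak_conv_bounded_support:
  assumes "\<And>n. real_distribution (\<mu> n)" "real_distribution M" "weak_conv_m \<mu> M"
    and "\<And>n. AE x in \<mu> n. a \<le> x \<and> x \<le> b"
  shows "AE x in M. a \<le> x \<and> x \<le> (b::real)"
proof -
  interpret M: real_distribution M by fact
  define f where "f = (\<lambda>x. min 1 (max (a - x) 0 + max (x - b) 0))"
  have [measurable]: "f \<in> borel_measurable borel" unfolding f_def by measurable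
  have f0: "integral\<^sup>L (\<mu> n) f = 0" for n
  proof (rule integral_eq_zero_AE)
    show "AE x in \<mu> n. f x = 0"
      using assms(4)[of n] by eventually_elim (auto simp: f_def)
  qed
  have "(\<lambda>n. integral\<^sup>L (\<mu> n) f) \<longlonglongrightarrow> integral\<^sup>L M f"
    by (rule weak_conv_imp_integral_bdd_continuous_conv[OF assms(1-3), of _ 1])
      (auto simp: f_def intro!: continuous_intros)
  then have "integral\<^sup>L M f = 0"
    by (simp add: f0 LIMSEQ_const_iff)
  moreover have "integrable M f"
    by (intro M.integrable_const_bound[of _ 1]) (auto simp: f_def)
  ultimately have "AE x in M. f x = 0"
    by (subst (asm) integral_nonneg_eq_0_iff_AE) (auto simp: f_def)
  then show ?thesis
    by (rule eventually_mono) (auto simp: f_def min_def max_def split: if_splits)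
qed

lemma tight_bounded_support:
  assumes "\<And>n. real_distribution (\<mu> n)" "\<And>n. AE x in \<mu> n. a \<le> x \<and> x \<le> (b::real)"
  shows "tight \<mu>"
  unfolding tight_def
proof (intro conjI allI impI)
  fix \<epsilon> :: real assume "0 < \<epsilon>"
  define b' where "b' = max a b"
  have "measure (\<mu> n) {a - 1<..b'} > 1 - \<epsilon>" for n
  proof -
    interpret real_distribution "\<mu> n" by (rule assms)
    have "AE x in \<mu> n. x \<in> {a - 1<..b'}"
      using assms(2)[of n] by eventually_elim (auto simp: b'_def)
    then have "measure (\<mu> n) {a - 1<..b'} = 1"
      by (subst prob_eq_1) auto
    then show ?thesis using \<open>0 < \<epsilon>\<close> by simp
  qed
  moreover have "a - 1 < b'" by (simp add: b'_def)
  ultimately show "\<exists>a b. a < b \<and> (\<forall>n. measure (\<mu> n) {a<..b} > 1 - \<epsilon>)" by blast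
qed (rule assms)

lemma tendsto_char_dist_eq_rhs:
  assumes "\<And>n. real_distribution (\<mu> n)" "real_distribution \<nu>"
    and "\<And>t. (\<lambda>n. char (\<mu> n) t) \<longlonglongrightarrow> char \<nu> t"
  shows "(\<lambda>n. char (dist_eq_rhs c (\<mu> n)) t) \<longlonglongrightarrow> char (dist_eq_rhs c \<nu>) t"
  unfolding char_dist_eq_rhs[OF assms(1)] char_dist_eq_rhs[OF assms(2)]
proof (rule integral_dominated_convergence[where w = "\<lambda>_. 1"])
  show "(\<lambda>u. iexp (t * toll c u) * char \<nu> (t * (share c u)\<^sup>2) * char \<nu> (t * (1 - share c u)\<^sup>2))
          \<in> borel_measurable unif"
    using measurable_char_dist_eq_rhs_integrand[OF assms(2)] by simp
  show "(\<lambda>u. iexp (t * toll c u) * char (\<mu> n) (t * (share c u)\<^sup>2) * char (\<mu> n) (t * (1 - share c u)\<^sup>2))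
          \<in> borel_measurable unif" for n
    using measurable_char_dist_eq_rhs_integrand[OF assms(1)] by simp
  show "AE u in unif. norm (iexp (t * toll c u) * char (\<mu> n) (t * (share c u)\<^sup>2) *
          char (\<mu> n) (t * (1 - share c u)\<^sup>2)) \<le> 1" for n
    using real_distribution.cmod_char_le_1[OF assms(1)[of n]]
    by (auto simp: norm_mult intro!: mult_le_one AE_I2)
  show "integrable unif (\<lambda>_. 1 :: real)"
    by (rule integrable_unif_bounded[of _ 1]) auto
  show "AE u in unif. (\<lambda>n. iexp (t * toll c u) * char (\<mu> n) (t * (share c u)\<^sup>2) *
          char (\<mu> n) (t * (1 - share c u)\<^sup>2))
        \<longlonglongrightarrow> iexp (t * toll c u) * char \<nu> (t * (share c u)\<^sup>2) * char \<nu> (t * (1 - share c u)\<^sup>2)"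
    by (intro AE_I2 tendsto_mult tendsto_const assms(3))
qed

text \<open>
  Iterate the right-hand side, starting from the point mass at 0. The supports stay in
  \<open>[0, 1 / (2 * c)]\<close>, so some subsequence converges weakly. By the contraction the characteristic functions
  of consecutive iterates approach each other, and therefore the weak limit is a fixed point.
\<close>

lemma finite_mean_solution_exists:
  assumes c: "0 < c" "c \<le> 1"
  shows "\<exists>\<mu>. finite_mean_solution c \<mu> \<and> (AE x in \<mu>. 0 \<le> x \<and> x \<le> 1 / (2 * c))"
proof -
  define \<mu> where "\<mu> k = (dist_eq_rhs c ^^ k) (return borel 0)" for k
  have \<mu>_Suc: "dist_eq_rhs c (\<mu> k) = \<mu> (Suc k)" for k
    by (simp add: \<mu>_def)
  have *: "real_distribution (\<mu> k) \<and> (AE x in \<mu> k. 0 \<le> x \<and> x \<le> 1 / (2 * c))" for k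
  proof (induction k)
    case 0
    interpret prob_space "return borel (0::real)" by (rule prob_space_return) simp
    show ?case
    proof
      show "real_distribution (\<mu> 0)"
        unfolding \<mu>_def by (simp add: real_distribution_def real_distribution_axioms_def prob_space_axioms)
      show "AE x in \<mu> 0. 0 \<le> x \<and> x \<le> 1 / (2 * c)"
        using c unfolding \<mu>_def funpow_0 by (subst AE_return) auto
    qed
  next
    case (Suc k)
    then show ?case
      unfolding \<mu>_Suc[symmetric] using c by (blast intro: real_distribution_dist_eq_rhs dist_eq_rhs_support)
  qed
  then have rd: "real_distribution (\<mu> k)" and supp: "AE x in \<mu> k. 0 \<le> x \<and> x \<le> 1 / (2 * c)" for k
    by blast+
  have "tight \<mu>"
    by (rule tight_bounded_support[OF rd supp])
  then obtain r M where r: "strict_mono (r :: nat \<Rightarrow> nat)" and M: "real_distribution M"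
    and "weak_conv_m (\<mu> \<circ> id \<circ> r) M"
    using tight_imp_convergent_subsubsequence[OF _ strict_mono_id] by metis
  then have wc: "weak_conv_m (\<lambda>k. \<mu> (r k)) M" by (simp add: o_def)
  interpret M: real_distribution M by (rule M)
  have supp_M: "AE x in M. 0 \<le> x \<and> x \<le> 1 / (2 * c)"
    by (rule weak_conv_bounded_support[OF rd M wc supp])
  have conv: "(\<lambda>k. char (\<mu> (r k)) t) \<longlonglongrightarrow> char M t" for t
    by (rule levy_continuity1[OF rd M wc])
  interpret D: real_distribution "\<mu> 1" by (rule rd)
  define K where "K = D.expectation (\<lambda>x. \<bar>x\<bar>)"
  have step: "norm (char (\<mu> (Suc k)) t - char (\<mu> k) t) \<le> K * (2 / 3) ^ k * \<bar>t\<bar>" for k t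
  proof (induction k arbitrary: t)
    case 0
    have "char (\<mu> 0) t = 1"
      by (simp add: \<mu>_def char_def integral_return)
    then show ?case
      using D.norm_char_minus_1_le[of t] D.integrable_bounded_support[OF supp, of 1]
      by (simp add: K_def mult.commute)
  next
    case (Suc k)
    have "norm (char (dist_eq_rhs c (\<mu> (Suc k))) t - char (dist_eq_rhs c (\<mu> k)) t) \<le> 2 / 3 * (K * (2 / 3) ^ k) * \<bar>t\<bar>"
      using c by (intro char_dist_eq_rhs_contraction rd Suc.IH) auto
    then show ?case by (simp add: \<mu>_Suc mult_ac)
  qed
  have "char (dist_eq_rhs c M) t = char M t" for t
  proof (rule LIMSEQ_unique)
    show "(\<lambda>k. char (dist_eq_rhs c (\<mu> (r k))) t) \<longlonglongrightarrow> char (dist_eq_rhs c M) t"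
      by (rule tendsto_char_dist_eq_rhs[OF rd M conv])
    \<comment> \<open>The next iterate has the same limit along the subsequence.\<close>
    have "(\<lambda>k. K * (2 / 3) ^ k * \<bar>t\<bar>) \<longlonglongrightarrow> K * 0 * \<bar>t\<bar>"
      by (intro tendsto_intros LIMSEQ_realpow_zero) auto
    then have "(\<lambda>k. char (\<mu> (Suc k)) t - char (\<mu> k) t) \<longlonglongrightarrow> 0"
      by (intro Lim_null_comparison[OF always_eventually, rule_format, OF step]) simp
    then have "(\<lambda>k. char (\<mu> (Suc (r k))) t - char (\<mu> (r k)) t) \<longlonglongrightarrow> 0"
      using LIMSEQ_subseq_LIMSEQ[OF _ r, of "\<lambda>k. char (\<mu> (Suc k)) t - char (\<mu> k) t"] by (simp add: o_def)
    from tendsto_add[OF this conv[of t]]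
    show "(\<lambda>k. char (dist_eq_rhs c (\<mu> (r k))) t) \<longlonglongrightarrow> char M t"
      by (simp add: \<mu>_Suc)
  qed
  then have "dist_eq_rhs c M = M"
    by (intro Levy_uniqueness real_distribution_dist_eq_rhs M) auto
  then show ?thesis
    using M supp_M M.integrable_bounded_support[OF supp_M, of 1]
    unfolding finite_mean_solution_def by auto
qed

section \<open>Mean and variance of the solution\<close>

text \<open>
  Taking means in the distributional equation gives a linear equation for the mean.
\<close>

lemma finite_mean_solution_expectation:
  assumes c: "0 < c" "c \<le> 1" and sol: "finite_mean_solution c \<mu>"
  shows "prob_space.expectation \<mu> (\<lambda>x. x) = (2 - c) / (2 * (1 + 2 * c - 2 * c\<^sup>2))"
proof -
  interpret real_distribution \<mu> using sol by (simp add: finite_mean_solution_def)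
  have int: "integrable \<mu> (\<lambda>x. x)" and fix_eq: "dist_eq_rhs c \<mu> = \<mu>"
    using sol by (simp_all add: finite_mean_solution_def)
  define m where "m = expectation (\<lambda>x. x)"
  have "m = (\<integral>u. \<integral>x'. \<integral>x. (share c u)\<^sup>2 * x + (1 - share c u)\<^sup>2 * x' + toll c u \<partial>\<mu> \<partial>\<mu> \<partial>unif)"
    using integral_dist_eq_rhs[OF real_distribution_axioms, of c "\<lambda>x. x"] int by (simp add: fix_eq m_def)
  also have "\<dots> = (\<integral>u. (share c u)\<^sup>2 * m + (1 - share c u)\<^sup>2 * m + toll c u \<partial>unif)"
    using int by (simp add: prob_space[simplified] m_def)
  also have "\<dots> = (\<integral>u. ((1 - 2 * (c * (1 - c))) * m + (1 - c) / 2)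
      + (- 2 * (1 - 2 * c)\<^sup>2 * m - (1 - 2 * c)) * (u * (1 - u)) + 0 * (u * (1 - u))\<^sup>2 \<partial>unif)"
  proof (intro Bochner_Integration.integral_cong refl)
    fix u
    have "(share c u)\<^sup>2 * m + (1 - share c u)\<^sup>2 * m = (1 - 2 * (share c u * (1 - share c u))) * m"
      by (simp add: power2_eq_square algebra_simps)
    then show "(share c u)\<^sup>2 * m + (1 - share c u)\<^sup>2 * m + toll c u =
       ((1 - 2 * (c * (1 - c))) * m + (1 - c) / 2)
      + (- 2 * (1 - 2 * c)\<^sup>2 * m - (1 - 2 * c)) * (u * (1 - u)) + 0 * (u * (1 - u))\<^sup>2"
      unfolding share_prod_eq toll_eq by (simp add: algebra_simps)
  qed
  finally have "m = ((1 - 2 * (c * (1 - c))) * m + (1 - c) / 2) + (- 2 * (1 - 2 * c)\<^sup>2 * m - (1 - 2 * c)) / 6"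
    unfolding integral_unif_quadratic by simp
  then have "m * (2 * (1 + 2 * c - 2 * c\<^sup>2)) = 2 - c"
    by (simp add: power2_eq_square field_simps)
  moreover have "1 + 2 * c - 2 * c\<^sup>2 > 0"
  proof -
    have "c * c \<le> c" using c mult_left_mono[of c 1 c] by simp
    then show ?thesis unfolding power2_eq_square by linarith
  qed
  ultimately show ?thesis by (simp add: m_def field_simps)
qed

text \<open>
  Taking second moments gives a linear equation for the second moment, with polynomials in
  \<open>e = c * (1 - c)\<close> and \<open>d = 1 - 2 * c\<close> as coefficients. The mean of \<open>1 - v ^ 4 - (1 - v) ^ 4\<close> for
  \<open>v = share c u\<close> is one fifth of the last factor in the denominator of the variance.
\<close>

lemma finite_mean_solution_variance:
  assumes c: "0 < c" "c \<le> 1" and sol: "finite_mean_solution c \<mu>" and int2: "integrable \<mu> (\<lambda>x. x\<^sup>2)"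
  shows "prob_space.variance \<mu> (\<lambda>x. x) =
       (1 - c)\<^sup>2 * (1 - 2 * c)\<^sup>2 /
       (4 * (1 + 2 * c - 2 * c\<^sup>2)\<^sup>2 * (3 + 6 * c - 8 * c\<^sup>2 + 4 * c ^ 3 - 2 * c ^ 4))"
proof -
  interpret real_distribution \<mu> using sol by (simp add: finite_mean_solution_def)
  have int: "integrable \<mu> (\<lambda>x. x)" and fix_eq: "dist_eq_rhs c \<mu> = \<mu>"
    using sol by (simp_all add: finite_mean_solution_def)
  define m where "m = expectation (\<lambda>x. x)"
  define s where "s = expectation (\<lambda>x. x\<^sup>2)"
  define e where "e = c * (1 - c)"
  define d where "d = 1 - 2 * c"
  have "s = (\<integral>u. \<integral>x'. \<integral>x. ((share c u)\<^sup>2 * x + (1 - share c u)\<^sup>2 * x' + toll c u)\<^sup>2 \<partial>\<mu> \<partial>\<mu> \<partial>unif)"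
    using integral_dist_eq_rhs[OF real_distribution_axioms, of c "\<lambda>x. x\<^sup>2"] int2 by (simp add: fix_eq s_def)
  also have "\<dots> = (\<integral>u. (share c u)^4 * s + (1 - share c u)^4 * s + (toll c u)\<^sup>2
     + 2 * (share c u)\<^sup>2 * (1 - share c u)\<^sup>2 * m * m + 2 * (share c u)\<^sup>2 * toll c u * m
     + 2 * (1 - share c u)\<^sup>2 * toll c u * m \<partial>unif)"
  proof (intro Bochner_Integration.integral_cong refl)
    fix u
    define a where "a = (share c u)\<^sup>2"
    define b where "b = (1 - share c u)\<^sup>2"
    define T where "T = toll c u"
    have "(\<integral>x. (a * x + b * x' + T)\<^sup>2 \<partial>\<mu>) = a\<^sup>2 * s + b\<^sup>2 * x'\<^sup>2 + T\<^sup>2 + 2 * a * b * m * x' + 2 * a * T * m + 2 * b * T * x'" for x'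
    proof -
      have "(\<integral>x. (a * x + b * x' + T)\<^sup>2 \<partial>\<mu>) = (\<integral>x. a\<^sup>2 * x\<^sup>2 + (2 * a * (b * x' + T)) * x + (b * x' + T)\<^sup>2 \<partial>\<mu>)"
        by (intro Bochner_Integration.integral_cong refl) (simp add: power2_eq_square algebra_simps)
      also have "\<dots> = a\<^sup>2 * s + (2 * a * (b * x' + T)) * m + (b * x' + T)\<^sup>2"
        using int int2 by (simp add: m_def s_def prob_space[simplified])
      finally show ?thesis by (simp add: power2_eq_square algebra_simps)
    qed
    then have "(\<integral>x'. \<integral>x. (a * x + b * x' + T)\<^sup>2 \<partial>\<mu> \<partial>\<mu>) =
        (\<integral>x'. b\<^sup>2 * x'\<^sup>2 + (2 * a * b * m + 2 * b * T) * x' + (a\<^sup>2 * s + T\<^sup>2 + 2 * a * T * m) \<partial>\<mu>)"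
      by (intro Bochner_Integration.integral_cong refl) (simp add: algebra_simps)
    also have "\<dots> = b\<^sup>2 * s + (2 * a * b * m + 2 * b * T) * m + (a\<^sup>2 * s + T\<^sup>2 + 2 * a * T * m)"
      using int int2 by (simp add: m_def s_def prob_space[simplified])
    finally show "(\<integral>x'. \<integral>x. ((share c u)\<^sup>2 * x + (1 - share c u)\<^sup>2 * x' + toll c u)\<^sup>2 \<partial>\<mu> \<partial>\<mu>) = 
     (share c u)^4 * s + (1 - share c u)^4 * s + (toll c u)\<^sup>2
     + 2 * (share c u)\<^sup>2 * (1 - share c u)\<^sup>2 * m * m + 2 * (share c u)\<^sup>2 * toll c u * m
     + 2 * (1 - share c u)\<^sup>2 * toll c u * m"
      by (simp add: a_def b_def T_def algebra_simps flip: power_mult)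
  qed
  also have "\<dots> = (\<integral>u. ((1 - 4 * e + 2 * e\<^sup>2) * s + 2 * e\<^sup>2 * m\<^sup>2 + (1 - 2 * e) * (1 - c) * m + (1 - c)\<^sup>2 / 4)
     + ((4 * e - 4) * d\<^sup>2 * s + 4 * e * d\<^sup>2 * m\<^sup>2 - (2 * (1 - 2 * e) * d + 2 * d\<^sup>2 * (1 - c)) * m - (1 - c) * d) * (u * (1 - u))
     + (2 * d ^ 4 * s + 2 * d ^ 4 * m\<^sup>2 + 4 * d ^ 3 * m + d\<^sup>2) * (u * (1 - u))\<^sup>2 \<partial>unif)"
  proof (intro Bochner_Integration.integral_cong refl)
    fix u
    define v where "v = share c u"
    define T where "T = toll c u"
    define y where "y = u * (1 - u)"
    have q: "v * (1 - v) = e + d\<^sup>2 * y" and T: "T = (1 - c) / 2 - d * y"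
      unfolding v_def T_def y_def e_def d_def by (rule share_prod_eq, rule toll_eq)
    \<comment> \<open>By \<open>v\<^sup>2 + (1 - v)\<^sup>2 = 1 - 2 * v * (1 - v)\<close> everything is expressed through \<open>v * (1 - v)\<close>.\<close>
    have "v ^ 4 * s + (1 - v) ^ 4 * s + T\<^sup>2 + 2 * v\<^sup>2 * (1 - v)\<^sup>2 * m * m + 2 * v\<^sup>2 * T * m + 2 * (1 - v)\<^sup>2 * T * m
      = (1 - 4 * (v * (1 - v)) + 2 * (v * (1 - v))\<^sup>2) * s + T\<^sup>2 + 2 * (v * (1 - v))\<^sup>2 * m * m + 2 * (1 - 2 * (v * (1 - v))) * T * m"
      by (simp add: power2_eq_square power4_eq_xxxx algebra_simps)
    also have "\<dots> = ((1 - 4 * e + 2 * e\<^sup>2) * s + 2 * e\<^sup>2 * m\<^sup>2 + (1 - 2 * e) * (1 - c) * m + (1 - c)\<^sup>2 / 4)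
     + ((4 * e - 4) * d\<^sup>2 * s + 4 * e * d\<^sup>2 * m\<^sup>2 - (2 * (1 - 2 * e) * d + 2 * d\<^sup>2 * (1 - c)) * m - (1 - c) * d) * y
     + (2 * d ^ 4 * s + 2 * d ^ 4 * m\<^sup>2 + 4 * d ^ 3 * m + d\<^sup>2) * y\<^sup>2"
      unfolding q T by (simp add: power2_eq_square power3_eq_cube power4_eq_xxxx field_simps)
    finally show "share c u ^ 4 * s + (1 - share c u) ^ 4 * s + (toll c u)\<^sup>2 + 2 * (share c u)\<^sup>2 * (1 - share c u)\<^sup>2 * m * m
       + 2 * (share c u)\<^sup>2 * toll c u * m + 2 * (1 - share c u)\<^sup>2 * toll c u * m
      = ((1 - 4 * e + 2 * e\<^sup>2) * s + 2 * e\<^sup>2 * m\<^sup>2 + (1 - 2 * e) * (1 - c) * m + (1 - c)\<^sup>2 / 4)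
     + ((4 * e - 4) * d\<^sup>2 * s + 4 * e * d\<^sup>2 * m\<^sup>2 - (2 * (1 - 2 * e) * d + 2 * d\<^sup>2 * (1 - c)) * m - (1 - c) * d) * (u * (1 - u))
     + (2 * d ^ 4 * s + 2 * d ^ 4 * m\<^sup>2 + 4 * d ^ 3 * m + d\<^sup>2) * (u * (1 - u))\<^sup>2"
      unfolding v_def T_def y_def .
  qed
  finally have s_eq: "s = ((1 - 4 * e + 2 * e\<^sup>2) * s + 2 * e\<^sup>2 * m\<^sup>2 + (1 - 2 * e) * (1 - c) * m + (1 - c)\<^sup>2 / 4)
     + ((4 * e - 4) * d\<^sup>2 * s + 4 * e * d\<^sup>2 * m\<^sup>2 - (2 * (1 - 2 * e) * d + 2 * d\<^sup>2 * (1 - c)) * m - (1 - c) * d) / 6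
     + (2 * d ^ 4 * s + 2 * d ^ 4 * m\<^sup>2 + 4 * d ^ 3 * m + d\<^sup>2) / 30"
    unfolding integral_unif_quadratic .
  define D where "D = 1 + 2 * c - 2 * c\<^sup>2"
  define P where "P = 3 + 6 * c - 8 * c\<^sup>2 + 4 * c ^ 3 - 2 * c ^ 4"
  have e: "0 \<le> e" "e \<le> 1"
    using c by (auto simp: e_def intro: mult_le_one)
  have D_pos: "D > 0"
    using e by (simp add: D_def e_def power2_eq_square algebra_simps)
  have "P = 3 + 6 * e - 2 * e\<^sup>2"
    by (simp add: P_def e_def power2_eq_square power3_eq_cube power4_eq_xxxx algebra_simps)
  moreover have "e\<^sup>2 \<le> 1"
    using e by (simp add: power_le_one)
  ultimately have P_pos: "P > 0" using e by simp
  have m: "m * (2 * D) = 2 - c"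
    using finite_mean_solution_expectation[OF c sol] D_pos by (simp add: m_def D_def)
  \<comment> \<open>All terms of the equation for \<open>s\<close> without \<open>s\<close>.\<close>
  define R where "R = (2 * e\<^sup>2 + 4 * e * d\<^sup>2 / 6 + 2 * d ^ 4 / 30) * m\<^sup>2
     + ((1 - 2 * e) * (1 - c) - (2 * (1 - 2 * e) * d + 2 * d\<^sup>2 * (1 - c)) / 6 + 4 * d ^ 3 / 30) * m
     + ((1 - c)\<^sup>2 / 4 - (1 - c) * d / 6 + d\<^sup>2 / 30)"
  have sX: "s * (1 - (1 - 4 * e + 2 * e\<^sup>2) - (4 * e - 4) * d\<^sup>2 / 6 - 2 * d ^ 4 / 30) = R"
    using s_eq unfolding R_def by (simp add: field_simps)
  have X: "1 - (1 - 4 * e + 2 * e\<^sup>2) - (4 * e - 4) * d\<^sup>2 / 6 - 2 * d ^ 4 / 30 = P / 5"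
    unfolding P_def e_def d_def by (simp add: power2_eq_square power3_eq_cube power4_eq_xxxx field_simps)
  have sP: "s * P = 5 * R" using sX unfolding X by simp
  have "4 * D\<^sup>2 * R = (2 * e\<^sup>2 + 4 * e * d\<^sup>2 / 6 + 2 * d ^ 4 / 30) * (m * (2 * D))\<^sup>2
     + ((1 - 2 * e) * (1 - c) - (2 * (1 - 2 * e) * d + 2 * d\<^sup>2 * (1 - c)) / 6 + 4 * d ^ 3 / 30) * (m * (2 * D)) * (2 * D)
     + ((1 - c)\<^sup>2 / 4 - (1 - c) * d / 6 + d\<^sup>2 / 30) * (4 * D\<^sup>2)"
    unfolding R_def by (simp add: power2_eq_square algebra_simps)
  then have DR: "4 * D\<^sup>2 * R = (2 * e\<^sup>2 + 4 * e * d\<^sup>2 / 6 + 2 * d ^ 4 / 30) * (2 - c)\<^sup>2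
     + ((1 - 2 * e) * (1 - c) - (2 * (1 - 2 * e) * d + 2 * d\<^sup>2 * (1 - c)) / 6 + 4 * d ^ 3 / 30) * (2 - c) * (2 * D)
     + ((1 - c)\<^sup>2 / 4 - (1 - c) * d / 6 + d\<^sup>2 / 30) * (4 * D\<^sup>2)"
    unfolding m .
  have "(s - m\<^sup>2) * (4 * D\<^sup>2 * P) = 4 * D\<^sup>2 * (s * P) - P * (m * (2 * D))\<^sup>2"
    by (simp add: power2_eq_square algebra_simps)
  also have "\<dots> = 5 * (4 * D\<^sup>2 * R) - P * (2 - c)\<^sup>2"
    unfolding sP m by simp
  also have "\<dots> = (1 - c)\<^sup>2 * (1 - 2 * c)\<^sup>2"
    unfolding DR unfolding D_def P_def e_def d_def
    by (simp add: power2_eq_square power3_eq_cube power4_eq_xxxx field_simps)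
  finally have "s - m\<^sup>2 = (1 - c)\<^sup>2 * (1 - 2 * c)\<^sup>2 / (4 * D\<^sup>2 * P)"
    using D_pos P_pos by (simp add: field_simps)
  moreover have "variance (\<lambda>x. x) = s - m\<^sup>2"
    unfolding s_def m_def using int int2 by (rule variance_eq)
  ultimately show ?thesis
    unfolding D_def P_def by simp
qed

section \<open>One level of the recursion as independent coins\<close>

text \<open>
  The procedure tosses its coins along the list. For distinct elements one may instead attach a coin
  to every element in advance, which makes the coins independent of the order of the list.
\<close>

lemma err_partition_distinct:
  assumes "distinct xs"
  shows "err_partition p x xs =
           map_pmf (\<lambda>w. partition (\<lambda>y. (y < x) \<noteq> w y) xs) (Pi_pmf (set xs) False (\<lambda>_. bernoulli_pmf p))"
  using assms
proof (induction xs)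
  case (Cons y ys)
  have "map_pmf (\<lambda>w. partition (\<lambda>z. (z < x) \<noteq> w z) (y # ys)) (Pi_pmf (set (y # ys)) False (\<lambda>_. bernoulli_pmf p))
    = do {wrong \<leftarrow> bernoulli_pmf p; w \<leftarrow> Pi_pmf (set ys) False (\<lambda>_. bernoulli_pmf p);
          return_pmf (partition (\<lambda>z. (z < x) \<noteq> (w(y := wrong)) z) (y # ys))}"
  proof -
    have "Pi_pmf (set (y # ys)) False (\<lambda>_. bernoulli_pmf p) =
      do {wrong \<leftarrow> bernoulli_pmf p; w \<leftarrow> Pi_pmf (set ys) False (\<lambda>_. bernoulli_pmf p); return_pmf (w(y := wrong))}"
      using Cons.prems by (simp add: Pi_pmf_insert')
    then show ?thesis by (simp only: map_bind_pmf map_return_pmf)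
  qed
  also have "\<dots> = do {wrong \<leftarrow> bernoulli_pmf p; w \<leftarrow> Pi_pmf (set ys) False (\<lambda>_. bernoulli_pmf p);
          return_pmf (case partition (\<lambda>z. (z < x) \<noteq> w z) ys of (ls, rs) \<Rightarrow>
             if (y < x) \<noteq> wrong then (y # ls, rs) else (ls, y # rs))}"
  proof (intro bind_pmf_cong refl)
    fix wrong w
    have *: "partition (\<lambda>z. (z < x) \<noteq> (w(y := wrong)) z) ys = partition (\<lambda>z. (z < x) \<noteq> w z) ys"
      using Cons.prems by (auto simp: intro!: filter_cong)
    show "return_pmf (partition (\<lambda>z. (z < x) \<noteq> (w(y := wrong)) z) (y # ys)) = 
        return_pmf (case partition (\<lambda>z. (z < x) \<noteq> w z) ys of (ls, rs) \<Rightarrow>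
             if (y < x) \<noteq> wrong then (y # ls, rs) else (ls, y # rs))"
      unfolding partition.simps * by (simp split: prod.split)
  qed
  also have "\<dots> = err_partition p x (y # ys)"
    using Cons by (simp add: bind_map_pmf case_prod_unfold o_def)
  finally show ?case ..
qed simp

definition cross_inversions :: "'a::linorder set \<Rightarrow> 'a set \<Rightarrow> nat" where
  "cross_inversions L R = card {(a, b). a \<in> L \<and> b \<in> R \<and> b < a}"

text \<open>
  Inversions within the first part, within the second part, and between the two.
\<close>

lemma inversions_append:
  "inversions (xs @ ys) = inversions xs + inversions ys +
     card {(i, j). i < length xs \<and> j < length ys \<and> ys ! j < xs ! i}"
proof -
  let ?n = "length xs"
  define A where "A = {(i, j). i < j \<and> j < length xs \<and> xs ! i > xs ! j}"
  define B where "B = {(i, j). i < j \<and> j < length ys \<and> ys ! i > ys ! j}"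
  define C where "C = {(i, j). i < length xs \<and> j < length ys \<and> ys ! j < xs ! i}"
  have eq: "{(i, j). i < j \<and> j < length (xs @ ys) \<and> (xs @ ys) ! i > (xs @ ys) ! j} =
    A \<union> ((\<lambda>(i, j). (i + ?n, j + ?n)) ` B \<union> (\<lambda>(i, j). (i, j + ?n)) ` C)" (is "?I = ?J")
  proof (intro equalityI subsetI)
    fix z assume "z \<in> ?I"
    then obtain i j where z: "z = (i, j)" "i < j" "j < ?n + length ys" "(xs @ ys) ! i > (xs @ ys) ! j" by auto
    consider "j < ?n" | "i < ?n" "?n \<le> j" | "?n \<le> i" by linarith
    then show "z \<in> ?J"
    proof cases
      case 1
      then show ?thesis using z by (auto simp: A_def nth_append)
    next
      case 2
      then have "(i, j - ?n) \<in> C" using z by (auto simp: C_def nth_append)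
      then show ?thesis using z 2 by (force simp: image_iff)
    next
      case 3
      then have "(i - ?n, j - ?n) \<in> B" using z by (auto simp: B_def nth_append)
      then have "(\<lambda>(i, j). (i + ?n, j + ?n)) (i - ?n, j - ?n) \<in> (\<lambda>(i, j). (i + ?n, j + ?n)) ` B" by (rule imageI)
      then show ?thesis using z 3 by auto
    qed
  qed (auto simp: A_def B_def C_def nth_append)
  have fin: "finite A" "finite B" "finite C"
    by (rule finite_subset[of _ "{..<length xs} \<times> {..<length xs}"], force simp: A_def, force)
      (rule finite_subset[of _ "{..<length ys} \<times> {..<length ys}"], force simp: B_def, force,
       rule finite_subset[of _ "{..<length xs} \<times> {..<length ys}"], force simp: C_def, force)
  have "inversions (xs @ ys) = card A + (card ((\<lambda>(i, j). (i + ?n, j + ?n)) ` B) + card ((\<lambda>(i, j). (i, j + ?n)) ` C))"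
    unfolding inversions_def eq using fin
    by (subst card_Un_disjoint; (subst card_Un_disjoint)?) (auto simp: A_def B_def C_def)
  also have "card ((\<lambda>(i, j). (i + ?n, j + ?n)) ` B) = card B"
    by (rule card_image) (auto simp: inj_on_def)
  also have "card ((\<lambda>(i, j). (i, j + ?n)) ` C) = card C"
    by (rule card_image) (auto simp: inj_on_def)
  finally show ?thesis by (simp add: inversions_def A_def B_def C_def)
qed

lemma inversions_append_distinct:
  assumes "distinct xs" "distinct ys"
  shows "inversions (xs @ ys) = inversions xs + inversions ys + cross_inversions (set xs) (set ys)"
proof -
  have "bij_betw (\<lambda>(i, j). (xs ! i, ys ! j)) {(i, j). i < length xs \<and> j < length ys \<and> ys ! j < xs ! i}
     {(a, b). a \<in> set xs \<and> b \<in> set ys \<and> b < a}"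
    using assms unfolding bij_betw_def
    by (auto simp: inj_on_def nth_eq_iff_index_eq image_iff in_set_conv_nth)
  then show ?thesis
    by (simp add: inversions_append cross_inversions_def bij_betw_same_card)
qed

lemma inversions_singleton [simp]: "inversions [x] = 0"
  by (auto simp: inversions_def card_eq_0_iff)

lemma inversions_Nil [simp]: "inversions [] = 0"
  by (auto simp: inversions_def)

text \<open>
  The inversions that a single call of the procedure creates: those that involve the pivot \<open>x\<close> and
  those between the two sublists. They depend on the sublists only as sets.
\<close>

definition toll_inversions :: "'a::linorder \<Rightarrow> 'a set \<Rightarrow> 'a set \<Rightarrow> nat" where
  "toll_inversions x L R = card {a \<in> L. x < a} + card {b \<in> R. b < x} + cross_inversions L R"

lemma inversions_pivot:
  assumes "distinct (ls @ x # rs)"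
  shows "inversions (ls @ x # rs) = inversions ls + inversions rs + toll_inversions x (set ls) (set rs)"
proof -
  have 1: "inversions (x # rs) = inversions rs + card {b \<in> set rs. b < x}"
  proof -
    have "{(a, b). a \<in> {x} \<and> b \<in> set rs \<and> b < a} = Pair x ` {b \<in> set rs. b < x}" by auto
    then have "cross_inversions {x} (set rs) = card {b \<in> set rs. b < x}"
      by (simp add: cross_inversions_def card_image inj_on_def)
    then show ?thesis
      using inversions_append_distinct[of "[x]" rs] assms by simp
  qed
  have 2: "cross_inversions (set ls) (insert x (set rs)) = card {a \<in> set ls. x < a} + cross_inversions (set ls) (set rs)"
  proof -
    have eq: "{(a, b). a \<in> set ls \<and> b \<in> insert x (set rs) \<and> b < a} =
       (\<lambda>a. (a, x)) ` {a \<in> set ls. x < a} \<union> {(a, b). a \<in> set ls \<and> b \<in> set rs \<and> b < a}" by auto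
    have "finite {(a, b). a \<in> set ls \<and> b \<in> set rs \<and> b < a}"
      by (rule finite_subset[of _ "set ls \<times> set rs"]) auto
    then show ?thesis
      unfolding cross_inversions_def eq using assms
      by (subst card_Un_disjoint) (auto simp: card_image inj_on_def)
  qed
  show ?thesis
    using inversions_append_distinct[of ls "x # rs"] assms by (simp add: 1 2 toll_inversions_def)
qed

abbreviation coins :: "real \<Rightarrow> 'a set \<Rightarrow> ('a \<Rightarrow> bool) pmf" where
  "coins p A \<equiv> Pi_pmf A False (\<lambda>_. bernoulli_pmf p)"

definition left_part :: "'a::linorder \<Rightarrow> ('a \<Rightarrow> bool) \<Rightarrow> 'a set \<Rightarrow> 'a set" where
  "left_part x w A = {y \<in> A. (y < x) \<noteq> w y}"

lemma finite_set_pmf_coins: "finite A \<Longrightarrow> finite (set_pmf (coins p A))"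
  by (rule finite_subset[OF set_Pi_pmf_subset']) (auto intro: finite_PiE_dflt)

lemma set_pmf_random_permutation:
  assumes "finite B" "xs \<in> set_pmf (pmf_of_set (permutations_of_set B))"
  shows "distinct xs" "set xs = B"
  using assms by (simp_all add: permutations_of_setD)

text \<open>
  Given the coins, partitioning a uniformly random permutation yields two independent uniformly
  random permutations of the two sides. So the two recursive calls produce independent numbers of
  inversions whose laws depend only on the sizes of the sublists.
\<close>

lemma err_inversions_on_rec:
  assumes "finite A" "A \<noteq> {}"
  shows "err_inversions_on A p = do {
     x \<leftarrow> pmf_of_set A;
     w \<leftarrow> coins p (A - {x});
     let L = left_part x w (A - {x});
     let R = A - {x} - L;
     i \<leftarrow> err_inversions (card L) p;
     j \<leftarrow> err_inversions (card R) p;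
     return_pmf (i + j + toll_inversions x L R)}"
proof -
  let ?perm = "\<lambda>B. pmf_of_set (permutations_of_set B)"
  have inner: "do {xs \<leftarrow> ?perm B; ys \<leftarrow> err_quicksort p (x # xs); return_pmf (inversions ys)} =
    do {w \<leftarrow> coins p B;
     let L = left_part x w B;
     let R = B - L;
     i \<leftarrow> err_inversions (card L) p;
     j \<leftarrow> err_inversions (card R) p;
     return_pmf (i + j + toll_inversions x L R)}" (is "?lhs = _")
    if fin: "finite B" and x: "x \<notin> B" for B and x :: 'a
  proof -
    let ?P = "\<lambda>w y. (y < x) \<noteq> w y"
    let ?k = "\<lambda>(ls, rs). do {ls' \<leftarrow> err_quicksort p ls; rs' \<leftarrow> err_quicksort p rs;
                            return_pmf (inversions (ls' @ x # rs'))}"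
    have "?lhs = do {xs \<leftarrow> ?perm B; w \<leftarrow> coins p B; ?k (partition (?P w) xs)}"
    proof (intro bind_pmf_cong refl)
      fix xs assume "xs \<in> set_pmf (?perm B)"
      then have xs: "distinct xs" "set xs = B"
        by (fact set_pmf_random_permutation[OF fin])+
      show "do {ys \<leftarrow> err_quicksort p (x # xs); return_pmf (inversions ys)} =
          do {w \<leftarrow> coins p B; ?k (partition (?P w) xs)}"
        unfolding err_quicksort.simps err_partition_distinct[OF xs(1)] xs(2)
        by (simp only: bind_assoc_pmf bind_map_pmf bind_return_pmf case_prod_unfold)
    qed
    also have "\<dots> = do {w \<leftarrow> coins p B; xs \<leftarrow> ?perm B; ?k (partition (?P w) xs)}"
      by (rule bind_commute_pmf)
    also have "\<dots> = do {w \<leftarrow> coins p B;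
       let L = left_part x w B;
       let R = B - L;
       i \<leftarrow> err_inversions (card L) p;
       j \<leftarrow> err_inversions (card R) p;
       return_pmf (i + j + toll_inversions x L R)}"
    proof (intro bind_pmf_cong refl)
      fix w
      define L where "L = left_part x w B"
      define R where "R = B - L"
      have LR: "{y \<in> B. ?P w y} = L" "{y \<in> B. \<not> ?P w y} = R"
        by (auto simp: L_def R_def left_part_def)
      have finLR: "finite L" "finite R" using fin by (auto simp: L_def R_def left_part_def)
      have xLR: "x \<notin> L" "x \<notin> R" "L \<inter> R = {}" using x by (auto simp: L_def R_def left_part_def)
      \<comment> \<open>The coins being fixed, the partition of the permutation is a pair of independent permutations.\<close>
      have "do {xs \<leftarrow> ?perm B; ?k (partition (?P w) xs)} =
          do {z \<leftarrow> map_pmf (partition (?P w)) (?perm B); ?k z}"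
        unfolding bind_map_pmf ..
      also have "\<dots> = do {z \<leftarrow> pair_pmf (?perm L) (?perm R); ?k z}"
        unfolding partition_random_permutations[OF fin] LR ..
      also have "\<dots> = do {ls \<leftarrow> ?perm L; rs \<leftarrow> ?perm R; ls' \<leftarrow> err_quicksort p ls; rs' \<leftarrow> err_quicksort p rs;
                            return_pmf (inversions (ls' @ x # rs'))}"
        by (simp only: pair_pmf_def bind_assoc_pmf bind_return_pmf prod.case)
      also have "\<dots> = do {ls \<leftarrow> ?perm L; rs \<leftarrow> ?perm R; ls' \<leftarrow> err_quicksort p ls; rs' \<leftarrow> err_quicksort p rs;
                            return_pmf (inversions ls' + inversions rs' + toll_inversions x L R)}"
      proof (intro bind_pmf_cong refl)
        fix ls rs ls' rs'
        assume *: "ls \<in> set_pmf (?perm L)" "rs \<in> set_pmf (?perm R)"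
          "ls' \<in> set_pmf (err_quicksort p ls)" "rs' \<in> set_pmf (err_quicksort p rs)"
        have "distinct ls'" "set ls' = L"
          using set_pmf_random_permutation[OF finLR(1) *(1)] mset_err_quicksort[OF *(3)]
            mset_eq_setD mset_eq_imp_distinct_iff by metis+
        moreover have "distinct rs'" "set rs' = R"
          using set_pmf_random_permutation[OF finLR(2) *(2)] mset_err_quicksort[OF *(4)]
            mset_eq_setD mset_eq_imp_distinct_iff by metis+
        ultimately show "return_pmf (inversions (ls' @ x # rs')) =
            return_pmf (inversions ls' + inversions rs' + toll_inversions x L R)"
          using xLR by (subst inversions_pivot) auto
      qed
      also have "\<dots> = do {ls \<leftarrow> ?perm L; ls' \<leftarrow> err_quicksort p ls; rs \<leftarrow> ?perm R; rs' \<leftarrow> err_quicksort p rs;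
                            return_pmf (inversions ls' + inversions rs' + toll_inversions x L R)}"
        by (rule bind_pmf_cong[OF refl]) (rule bind_commute_pmf)
      also have "\<dots> = do {i \<leftarrow> err_inversions_on L p; j \<leftarrow> err_inversions_on R p; return_pmf (i + j + toll_inversions x L R)}"
        by (simp only: err_inversions_on_def bind_assoc_pmf bind_return_pmf)
      also have "\<dots> = do {i \<leftarrow> err_inversions (card L) p; j \<leftarrow> err_inversions (card R) p; return_pmf (i + j + toll_inversions x L R)}"
        by (simp only: err_inversions_on_eq[OF finLR(1) refl] err_inversions_on_eq[OF finLR(2) refl])
      finally show "do {xs \<leftarrow> ?perm B; ?k (partition (?P w) xs)} = 
         (let L = left_part x w B; R = B - L in
       do {i \<leftarrow> err_inversions (card L) p;
       j \<leftarrow> err_inversions (card R) p;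
       return_pmf (i + j + toll_inversions x L R)})"
        by (simp add: L_def R_def Let_def)
    qed
    finally show ?thesis .
  qed
  have "err_inversions_on A p = do {x \<leftarrow> pmf_of_set A; xs \<leftarrow> ?perm (A - {x});
           ys \<leftarrow> err_quicksort p (x # xs); return_pmf (inversions ys)}"
    unfolding err_inversions_on_def random_permutation_of_set[OF assms]
    by (simp only: bind_assoc_pmf bind_return_pmf)
  also have "\<dots> = do {
     x \<leftarrow> pmf_of_set A;
     w \<leftarrow> coins p (A - {x});
     let L = left_part x w (A - {x});
     let R = A - {x} - L;
     i \<leftarrow> err_inversions (card L) p;
     j \<leftarrow> err_inversions (card R) p;
     return_pmf (i + j + toll_inversions x L R)}"
    by (rule bind_pmf_cong[OF refl], rule inner) (use assms in auto)
  finally show ?thesis .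
qed

section \<open>The recursion for the characteristic function of the number of inversions\<close>

lemma inversions_le: "inversions ys \<le> (length ys)\<^sup>2"
proof -
  have "inversions ys \<le> card ({..<length ys} \<times> {..<length ys})"
    unfolding inversions_def by (rule card_mono) auto
  then show ?thesis by (simp add: power2_eq_square)
qed

lemma err_inversions_le:
  assumes "i \<in> set_pmf (err_inversions n p)"
  shows "i \<le> n\<^sup>2"
proof -
  obtain xs ys where "xs \<in> permutations_of_set {1..n}" "ys \<in> set_pmf (err_quicksort p xs)" "i = inversions ys"
    using assms unfolding err_inversions_def err_inversions_on_def by auto
  then have "length ys = n"
    using mset_err_quicksort[of ys p xs] mset_eq_length[of ys xs] length_finite_permutations_of_set[of xs "{1..n}"]
    by auto
  then show ?thesis using inversions_le[of ys] \<open>i = inversions ys\<close> by simp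
qed

lemma finite_set_pmf_err_inversions: "finite (set_pmf (err_inversions n p))"
  by (rule finite_subset[of _ "{..n\<^sup>2}"]) (use err_inversions_le in auto)

lemma expectation_bind_finite:
  fixes h :: "'b \<Rightarrow> 'c::{banach, second_countable_topology}"
  assumes "finite (set_pmf p)" "\<And>x. x \<in> set_pmf p \<Longrightarrow> finite (set_pmf (f x))"
  shows "measure_pmf.expectation (bind_pmf p f) h =
           measure_pmf.expectation p (\<lambda>x. measure_pmf.expectation (f x) h)"
proof -
  have "measure_pmf.expectation p (\<lambda>x. measure_pmf.expectation (f x) h) =
      (\<Sum>x\<in>set_pmf p. pmf p x *\<^sub>R measure_pmf.expectation (f x) h)"
    by (rule integral_measure_pmf[OF assms(1)])
  also have "\<dots> = measure_pmf.expectation (bind_pmf p f) h"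
    by (rule pmf_expectation_bind[symmetric]) (use assms in auto)
  finally show ?thesis ..
qed

lemma expectation_pmf_of_set:
  fixes f :: "'a \<Rightarrow> complex"
  assumes "finite S" "S \<noteq> {}"
  shows "measure_pmf.expectation (pmf_of_set S) f = (\<Sum>x\<in>S. f x) / of_nat (card S)"
proof -
  have "measure_pmf.expectation (pmf_of_set S) f = (\<Sum>x\<in>S. pmf (pmf_of_set S) x *\<^sub>R f x)"
    by (rule integral_measure_pmf) (use assms in auto)
  also have "\<dots> = (\<Sum>x\<in>S. f x / of_nat (card S))"
    using assms by (intro sum.cong) (auto simp: scaleR_conv_of_real)
  finally show ?thesis by (simp add: sum_divide_distrib)
qed

text \<open>
  The characteristic function of the unnormalized number of inversions. Without normalization the
  recursion below has the same argument \<open>s\<close> on both sides.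
\<close>

definition err_char :: "real \<Rightarrow> nat \<Rightarrow> real \<Rightarrow> complex" where
  "err_char p n s = measure_pmf.expectation (err_inversions n p) (\<lambda>i. iexp (s * real i))"

text \<open>
  Given the pivot and the coins, the number of inversions is a constant plus two independent numbers
  of inversions, so the expectation of the exponential is a product.
\<close>

lemma err_char_rec:
  assumes "0 < n"
  shows "err_char p n s = (\<Sum>r<n. measure_pmf.expectation (coins p ({..<n} - {r}))
     (\<lambda>w. let L = left_part r w ({..<n} - {r}); R = {..<n} - {r} - L in
        iexp (s * real (toll_inversions r L R)) * err_char p (card L) s * err_char p (card R) s)) / of_nat n"
proof -
  have split: "measure_pmf.expectation (do {i \<leftarrow> err_inversions a p; j \<leftarrow> err_inversions b p; return_pmf (i + j + k)})
       (\<lambda>i. iexp (s * real i)) = iexp (s * real k) * err_char p a s * err_char p b s" for a b k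
  proof -
    have "measure_pmf.expectation (do {i \<leftarrow> err_inversions a p; j \<leftarrow> err_inversions b p; return_pmf (i + j + k)})
       (\<lambda>i. iexp (s * real i)) = measure_pmf.expectation (err_inversions a p) (\<lambda>i. 
          measure_pmf.expectation (err_inversions b p) (\<lambda>j. iexp (s * real (i + j + k))))"
      by (simp add: expectation_bind_finite finite_set_pmf_err_inversions integral_return)
    also have "\<dots> = measure_pmf.expectation (err_inversions a p) (\<lambda>i. 
          measure_pmf.expectation (err_inversions b p) (\<lambda>j. iexp (s * real k) * iexp (s * real i) * iexp (s * real j)))"
      by (simp add: algebra_simps flip: exp_add)
    also have "\<dots> = iexp (s * real k) * err_char p a s * err_char p b s"
      unfolding err_char_def by (simp add: mult.assoc flip: of_real_mult)
    finally show ?thesis .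
  qed
  let ?A = "{..<n}"
  let ?L = "\<lambda>r w. left_part r w (?A - {r})"
  let ?G = "\<lambda>r w. do {i \<leftarrow> err_inversions (card (?L r w)) p;
       j \<leftarrow> err_inversions (card (?A - {r} - ?L r w)) p;
       return_pmf (i + j + toll_inversions r (?L r w) (?A - {r} - ?L r w))}"
  have ne: "?A \<noteq> {}" using assms by auto
  have fin: "finite (set_pmf (?G r w))" for r w
    by (simp add: finite_set_pmf_err_inversions)
  have "err_inversions n p = err_inversions_on ?A p"
    by (rule err_inversions_on_eq[symmetric]) auto
  also have "\<dots> = bind_pmf (pmf_of_set ?A) (\<lambda>r. bind_pmf (coins p (?A - {r})) (?G r))"
    unfolding err_inversions_on_rec[OF finite_lessThan ne] Let_def ..
  finally have "err_char p n s = measure_pmf.expectation (pmf_of_set ?A) (\<lambda>r.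
      measure_pmf.expectation (bind_pmf (coins p (?A - {r})) (?G r)) (\<lambda>i. iexp (s * real i)))"
    unfolding err_char_def using ne fin
    by (simp only:) (rule expectation_bind_finite, simp_all add: finite_set_pmf_coins finite_set_pmf_err_inversions)
  also have "\<dots> = measure_pmf.expectation (pmf_of_set ?A) (\<lambda>r. measure_pmf.expectation (coins p (?A - {r}))
     (\<lambda>w. iexp (s * real (toll_inversions r (?L r w) (?A - {r} - ?L r w))) *
            err_char p (card (?L r w)) s * err_char p (card (?A - {r} - ?L r w)) s))"
  proof (intro Bochner_Integration.integral_cong refl)
    fix r
    have "measure_pmf.expectation (bind_pmf (coins p (?A - {r})) (?G r)) (\<lambda>i. iexp (s * real i)) =
      measure_pmf.expectation (coins p (?A - {r})) (\<lambda>w. measure_pmf.expectation (?G r w) (\<lambda>i. iexp (s * real i)))"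
      by (rule expectation_bind_finite) (simp_all add: finite_set_pmf_coins finite_set_pmf_err_inversions)
    then show "measure_pmf.expectation (bind_pmf (coins p (?A - {r})) (?G r)) (\<lambda>i. iexp (s * real i)) =
      measure_pmf.expectation (coins p (?A - {r})) (\<lambda>w. iexp (s * real (toll_inversions r (?L r w) (?A - {r} - ?L r w))) *
            err_char p (card (?L r w)) s * err_char p (card (?A - {r} - ?L r w)) s)"
      unfolding split .
  qed
  finally show ?thesis
    unfolding Let_def expectation_pmf_of_set[OF finite_lessThan ne] card_lessThan .
qed

lemma cmod_err_char_le_1: "norm (err_char p n s) \<le> 1"
proof -
  have "norm (err_char p n s) \<le> measure_pmf.expectation (err_inversions n p) (\<lambda>i. norm (iexp (s * real i)))"
    unfolding err_char_def by (rule integral_norm_bound)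
  then show ?thesis by (simp del: of_real_mult)
qed

lemma char_normalized_err_inversions:
  "char (normalized_err_inversions n p) t = err_char p n (t / ((real n)\<^sup>2 * p))"
  unfolding char_def normalized_err_inversions_def err_char_def
  by (simp add: integral_distr)

lemma real_distribution_normalized_err_inversions: "real_distribution (normalized_err_inversions n p)"
  unfolding normalized_err_inversions_def by (rule prob_space.real_distribution_distr) (auto intro: measure_pmf.prob_space_axioms)

lemma norm_err_char_minus_1_le: "norm (err_char p n s - 1) \<le> \<bar>s\<bar> * (real n)\<^sup>2"
proof -
  let ?E = "measure_pmf.expectation (err_inversions n p)"
  have int: "integrable (measure_pmf (err_inversions n p)) f" for f :: "nat \<Rightarrow> 'c::{banach, second_countable_topology}"
    by (intro integrable_measure_pmf_finite finite_set_pmf_err_inversions)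
  have eq: "err_char p n s - 1 = ?E (\<lambda>i. iexp (s * real i) - iexp 0)"
    unfolding err_char_def by (subst Bochner_Integration.integral_diff[OF int int]) simp
  have "norm (err_char p n s - 1) \<le> ?E (\<lambda>i. norm (iexp (s * real i) - iexp 0))"
    unfolding eq by (rule integral_norm_bound)
  also have "\<dots> \<le> ?E (\<lambda>i. \<bar>s\<bar> * (real n)\<^sup>2)"
  proof (rule integral_mono_AE[OF int int])
    show "AE i in err_inversions n p. norm (iexp (s * real i) - iexp 0) \<le> \<bar>s\<bar> * (real n)\<^sup>2"
    proof (rule AE_pmfI)
      fix i assume "i \<in> set_pmf (err_inversions n p)"
      then have "real i \<le> (real n)\<^sup>2"
        using err_inversions_le[of i n p] by (metis of_nat_le_iff of_nat_power)
      then have "\<bar>s\<bar> * real i \<le> \<bar>s\<bar> * (real n)\<^sup>2" by (intro mult_left_mono) auto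
      then show "norm (iexp (s * real i) - iexp 0) \<le> \<bar>s\<bar> * (real n)\<^sup>2"
        using norm_iexp_diff_le[of "s * real i" 0] by (simp only: diff_zero abs_mult abs_of_nat)
    qed
  qed
  finally show ?thesis by simp
qed

section \<open>Deviation of a function of independent coins from its mean\<close>

lemma integrable_coins [simp]:
  fixes f :: "('a \<Rightarrow> bool) \<Rightarrow> 'b::{banach, second_countable_topology}"
  shows "finite A \<Longrightarrow> integrable (measure_pmf (coins p A)) f"
  by (intro integrable_measure_pmf_finite finite_set_pmf_coins)

lemma expectation_coins_insert:
  fixes f :: "('a \<Rightarrow> bool) \<Rightarrow> real"
  assumes "finite A" "a \<notin> A" "0 \<le> p" "p \<le> 1"
  shows "measure_pmf.expectation (coins p (insert a A)) f =
     measure_pmf.expectation (coins p A) (\<lambda>w. p * f (w(a := True)) + (1 - p) * f (w(a := False)))"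
proof -
  have "coins p (insert a A) = bind_pmf (coins p A) (\<lambda>w. map_pmf (\<lambda>y. w(a := y)) (bernoulli_pmf p))"
    using assms by (subst Pi_pmf_insert', simp, simp, subst bind_commute_pmf) (simp add: map_pmf_def)
  moreover have "measure_pmf.expectation \<dots> f = measure_pmf.expectation (coins p A)
      (\<lambda>w. measure_pmf.expectation (map_pmf (\<lambda>y. w(a := y)) (bernoulli_pmf p)) f)"
    using assms(1) by (intro expectation_bind_finite finite_set_pmf_coins) auto
  ultimately show ?thesis
    using assms(3,4) by (simp only: integral_map_pmf integral_bernoulli_pmf mult.commute)
qed

text \<open>
  A bounded-differences bound on the variance. In the induction step the variance splits into the mean
  of the conditional variance of the new coin, which is at most \<open>K\<^sup>2\<close>, and the variance of the function
  averaged over that coin, which inherits the bounded differences.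
\<close>

lemma coins_variance_le:
  fixes f :: "('a \<Rightarrow> bool) \<Rightarrow> real"
  assumes p: "0 \<le> p" "p \<le> 1" and "finite A"
    and "\<And>w a b c. a \<in> A \<Longrightarrow> \<bar>f (w(a := b)) - f (w(a := c))\<bar> \<le> K"
  shows "measure_pmf.variance (coins p A) f \<le> real (card A) * K\<^sup>2"
  using assms(3,4)
proof (induction A arbitrary: f rule: finite_induct)
  case empty
  show ?case by (simp add: integral_return)
next
  case (insert a A)
  define g where "g w = p * f (w(a := True)) + (1 - p) * f (w(a := False))" for w
  define m where "m = measure_pmf.expectation (coins p A) g"
  have Ef: "measure_pmf.expectation (coins p (insert a A)) f = m"
    unfolding m_def g_def using insert.hyps p by (rule expectation_coins_insert)
  have "measure_pmf.variance (coins p (insert a A)) f =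
      measure_pmf.expectation (coins p A) (\<lambda>w. p * (f (w(a := True)) - m)\<^sup>2 + (1 - p) * (f (w(a := False)) - m)\<^sup>2)"
    unfolding Ef using insert.hyps p by (rule expectation_coins_insert)
  also have "\<dots> = measure_pmf.expectation (coins p A) (\<lambda>w. (g w - m)\<^sup>2 + p * (1 - p) * (f (w(a := True)) - f (w(a := False)))\<^sup>2)"
    unfolding g_def by (intro Bochner_Integration.integral_cong refl) (simp add: power2_eq_square algebra_simps)
  also have "\<dots> \<le> measure_pmf.expectation (coins p A) (\<lambda>w. (g w - m)\<^sup>2 + K\<^sup>2)"
  proof (intro integral_mono)
    fix w
    have "p * (1 - p) \<le> 1" using p by (simp add: mult_le_one)
    moreover have "(f (w(a := True)) - f (w(a := False)))\<^sup>2 \<le> K\<^sup>2"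
      using power_mono[OF insert.prems[of a w True False], of 2] by (simp only: insertI1 power2_abs abs_ge_zero)
    ultimately have "p * (1 - p) * (f (w(a := True)) - f (w(a := False)))\<^sup>2 \<le> 1 * K\<^sup>2"
      using p by (intro mult_mono) auto
    then show "(g w - m)\<^sup>2 + p * (1 - p) * (f (w(a := True)) - f (w(a := False)))\<^sup>2 \<le> (g w - m)\<^sup>2 + K\<^sup>2"
      by simp
  qed (rule integrable_coins[OF insert.hyps(1)])+
  also have "\<dots> = measure_pmf.variance (coins p A) g + K\<^sup>2"
    unfolding m_def[symmetric] using insert.hyps(1) by (subst Bochner_Integration.integral_add) simp_all
  also have "\<dots> \<le> real (card A) * K\<^sup>2 + K\<^sup>2"
  proof (intro add_right_mono insert.IH)
    fix w :: "'a \<Rightarrow> bool" and b c a' assume "a' \<in> A"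
    then have swap: "w(a' := b, a := y) = w(a := y, a' := b)" for b y :: bool
      using insert.hyps by (intro fun_upd_twist) auto
    have diff: "g (w(a' := b)) - g (w(a' := c)) =
       p * (f (w(a := True, a' := b)) - f (w(a := True, a' := c))) + (1 - p) * (f (w(a := False, a' := b)) - f (w(a := False, a' := c)))"
      unfolding g_def swap by (simp add: algebra_simps)
    have "\<bar>g (w(a' := b)) - g (w(a' := c))\<bar> \<le> p * \<bar>f (w(a := True, a' := b)) - f (w(a := True, a' := c))\<bar> + (1 - p) * \<bar>f (w(a := False, a' := b)) - f (w(a := False, a' := c))\<bar>"
      unfolding diff using p by (intro order_trans[OF abs_triangle_ineq]) (simp add: abs_mult)
    also have "\<dots> \<le> p * K + (1 - p) * K"
      by (intro add_mono mult_left_mono insert.prems) (use p \<open>a' \<in> A\<close> in auto)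
    finally show "\<bar>g (w(a' := b)) - g (w(a' := c))\<bar> \<le> K"
      by (simp add: algebra_simps)
  qed
  finally show ?case
    using insert.hyps by (simp add: algebra_simps)
qed

text \<open>
  Mean absolute deviation is at most standard deviation.
\<close>

lemma coins_deviation_le:
  fixes f :: "('a \<Rightarrow> bool) \<Rightarrow> real"
  assumes p: "0 \<le> p" "p \<le> 1" and A: "finite A" and "0 \<le> K"
    and "\<And>w a b c. a \<in> A \<Longrightarrow> \<bar>f (w(a := b)) - f (w(a := c))\<bar> \<le> K"
  shows "measure_pmf.expectation (coins p A) (\<lambda>w. \<bar>f w - measure_pmf.expectation (coins p A) f\<bar>)
           \<le> sqrt (real (card A)) * K"
proof -
  let ?E = "measure_pmf.expectation (coins p A)"
  let ?h = "\<lambda>w. \<bar>f w - ?E f\<bar>"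
  have "0 \<le> ?E (\<lambda>w. (?h w - ?E ?h)\<^sup>2)" by simp
  also have "\<dots> = ?E (\<lambda>w. (?h w)\<^sup>2) - (?E ?h)\<^sup>2"
    using A by (intro measure_pmf.variance_eq) auto
  finally have "(?E ?h)\<^sup>2 \<le> ?E (\<lambda>w. (f w - ?E f)\<^sup>2)" by simp
  also have "\<dots> \<le> real (card A) * K\<^sup>2"
    using assms by (intro coins_variance_le) auto
  also have "\<dots> = (sqrt (real (card A)) * K)\<^sup>2"
    by (simp add: power_mult_distrib)
  finally show ?thesis
    by (rule power2_le_imp_le) (use \<open>0 \<le> K\<close> in simp)
qed

section \<open>Sublist sizes and toll of one level\<close>

text \<open>
  Real-valued, so that sizes and numbers of inversions become polynomials in independent variables.
\<close>

definition goes_left :: "nat \<Rightarrow> (nat \<Rightarrow> bool) \<Rightarrow> nat \<Rightarrow> real" where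
  "goes_left r w y = of_bool ((y < r) \<noteq> w y)"

definition left_prob :: "real \<Rightarrow> nat \<Rightarrow> nat \<Rightarrow> real" where
  "left_prob p r y = (if y < r then 1 - p else p)"

lemma expectation_goes_left:
  assumes "finite A" "a \<in> A" and p: "0 \<le> p" "p \<le> 1"
  shows "measure_pmf.expectation (coins p A) (\<lambda>w. goes_left r w a) = left_prob p r a"
proof -
  define B where "B = A - {a}"
  have B: "A = insert a B" "a \<notin> B" "finite B" using assms by (auto simp: B_def)
  show ?thesis
    unfolding B(1) expectation_coins_insert[OF B(3,2) p]
    by (simp add: goes_left_def left_prob_def measure_pmf.prob_space[simplified])
qed

lemma expectation_goes_left_right:
  assumes "finite A" "a \<in> A" "b \<in> A" "a \<noteq> b" and p: "0 \<le> p" "p \<le> 1"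
  shows "measure_pmf.expectation (coins p A) (\<lambda>w. goes_left r w a * (1 - goes_left r w b)) =
           left_prob p r a * (1 - left_prob p r b)"
proof -
  define B where "B = A - {a, b}"
  have B: "A = insert a (insert b B)" "finite (insert b B)" "a \<notin> insert b B" "b \<notin> B" "finite B"
    using assms by (auto simp: B_def)
  have "b \<noteq> a" using assms by simp
  then show ?thesis
    unfolding B(1) expectation_coins_insert[OF B(2,3) p] expectation_coins_insert[OF B(5,4) p]
    by (simp add: goes_left_def left_prob_def measure_pmf.prob_space[simplified] algebra_simps)
qed

lemma card_left_part:
  assumes "finite A"
  shows "real (card (left_part r w A)) = (\<Sum>y\<in>A. goes_left r w y)"
proof -
  have "left_part r w A = {y \<in> A. (y < r) \<noteq> w y}" by (auto simp: left_part_def)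
  then show ?thesis
    using assms by (simp add: goes_left_def sum.If_cases of_bool_def Int_def)
qed

lemma cross_inversions_left_part:
  assumes "finite A"
  shows "real (cross_inversions (left_part r w A) (A - left_part r w A)) =
     (\<Sum>a\<in>A. \<Sum>b\<in>A. of_bool (b < a) * (goes_left r w a * (1 - goes_left r w b)))"
proof -
  let ?S = "{(a, b). a \<in> left_part r w A \<and> b \<in> A - left_part r w A \<and> b < a}"
  have "(\<Sum>a\<in>A. \<Sum>b\<in>A. of_bool (b < a) * (goes_left r w a * (1 - goes_left r w b))) =
      (\<Sum>(a, b)\<in>A \<times> A. of_bool (b < a) * (goes_left r w a * (1 - goes_left r w b)))"
    by (rule sum.cartesian_product)
  also have "\<dots> = (\<Sum>z\<in>A \<times> A. of_bool (z \<in> ?S))"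
    by (intro sum.cong refl) (auto simp: goes_left_def left_part_def)
  also have "\<dots> = real (card {z \<in> A \<times> A. z \<in> ?S})"
    using assms by (simp add: of_bool_def sum.If_cases Int_def del: mem_Collect_eq)
  also have "{z \<in> A \<times> A. z \<in> ?S} = ?S"
    by (auto simp: left_part_def)
  finally show ?thesis by (simp add: cross_inversions_def)
qed

lemma sum_less_pairs: "(\<Sum>a<n. \<Sum>b<n. of_bool (b < a) :: real) = real n * (real n - 1) / 2"
proof (induction n)
  case (Suc n)
  have "(\<Sum>a<Suc n. \<Sum>b<Suc n. of_bool (b < a) :: real) = (\<Sum>a<n. \<Sum>b<n. of_bool (b < a)) + real n"
  proof -
    have "(\<Sum>a<n. of_bool (n < a) :: real) = 0" by (rule sum.neutral) auto
    moreover have "(\<Sum>b<n. of_bool (b < n) :: real) = (\<Sum>b<n. 1)" by (intro sum.cong) auto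
    ultimately show ?thesis by (simp add: sum.distrib del: sum_of_bool_eq)
  qed
  then show ?case using Suc by (simp add: field_simps)
qed simp

lemma sum_remove_pivot:
  fixes f :: "nat \<Rightarrow> real"
  assumes "r < n"
  shows "(\<Sum>y\<in>{..<n} - {r}. f y) = (\<Sum>y<r. f y) + (\<Sum>y<n - 1 - r. f (y + Suc r))"
proof -
  have eq: "{..<n} - {r} = {..<r} \<union> (\<lambda>y. y + Suc r) ` {..<n - 1 - r}"
  proof (intro equalityI subsetI)
    fix y assume y: "y \<in> {..<n} - {r}"
    show "y \<in> {..<r} \<union> (\<lambda>y. y + Suc r) ` {..<n - 1 - r}"
    proof (cases "y < r")
      case False
      then have "y = (y - Suc r) + Suc r" "y - Suc r \<in> {..<n - 1 - r}" using y by auto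
      then show ?thesis by blast
    qed simp
  qed (use assms in auto)
  have "(\<Sum>y\<in>{..<n} - {r}. f y) = (\<Sum>y<r. f y) + sum f ((\<lambda>y. y + Suc r) ` {..<n - 1 - r})"
    unfolding eq by (rule sum.union_disjoint) auto
  also have "sum f ((\<lambda>y. y + Suc r) ` {..<n - 1 - r}) = (\<Sum>y<n - 1 - r. f (y + Suc r))"
    by (subst sum.reindex) (auto simp: inj_on_def)
  finally show ?thesis .
qed

context
  fixes p :: real and n r :: nat
  assumes p: "0 < p" "p \<le> 1" and r: "r < n"
begin

abbreviation "others \<equiv> {..<n} - {r}"
abbreviation "left w \<equiv> left_part r w others"
abbreviation "right w \<equiv> others - left w"
abbreviation "coinE \<equiv> measure_pmf.expectation (coins p others)"

lemma card_others: "card others = n - 1" using r by simp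

lemma expectation_card_left:
  "coinE (\<lambda>w. real (card (left w))) = real r * (1 - p) + (real n - 1 - real r) * p"
proof -
  have "coinE (\<lambda>w. real (card (left w))) = (\<Sum>y\<in>others. left_prob p r y)"
    using p by (simp add: card_left_part expectation_goes_left)
  also have "\<dots> = real r * (1 - p) + (real n - 1 - real r) * p"
    using r by (simp add: sum_remove_pivot left_prob_def of_nat_diff)
  finally show ?thesis .
qed

text \<open>
  Two elements on the same side of the pivot are exchanged with probability \<open>p * (1 - p)\<close>, two
  elements on different sides with probability \<open>p\<^sup>2\<close>.
\<close>

lemma expectation_cross:
  "coinE (\<lambda>w. real (cross_inversions (left w) (right w))) =
     p * (1 - p) * (real r * (real r - 1) / 2 + (real n - 1 - real r) * (real n - 2 - real r) / 2)
     + p\<^sup>2 * real r * (real n - 1 - real r)"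
proof -
  let ?k = "n - 1 - r"
  have k: "real ?k = real n - 1 - real r" using r by (simp add: of_nat_diff)
  have "coinE (\<lambda>w. real (cross_inversions (left w) (right w))) =
      (\<Sum>a\<in>others. \<Sum>b\<in>others. coinE (\<lambda>w. of_bool (b < a) * (goes_left r w a * (1 - goes_left r w b))))"
    by (simp add: cross_inversions_left_part Bochner_Integration.integral_sum del: integral_mult_right_zero)
  also have "\<dots> = (\<Sum>a\<in>others. \<Sum>b\<in>others. of_bool (b < a) * (left_prob p r a * (1 - left_prob p r b)))"
  proof (intro sum.cong refl)
    fix a b assume "a \<in> others" "b \<in> others"
    then show "coinE (\<lambda>w. of_bool (b < a) * (goes_left r w a * (1 - goes_left r w b))) =
        of_bool (b < a) * (left_prob p r a * (1 - left_prob p r b))"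
      using expectation_goes_left_right[of others a b p r] p by (cases "b < a") auto
  qed
  also have "\<dots> = (\<Sum>a<r. \<Sum>b<r. of_bool (b < a)) * (p * (1 - p)) + (\<Sum>a<?k. \<Sum>b<?k. of_bool (b < a)) * (p * (1 - p))
       + real r * real ?k * (p * p)"
    using r by (simp add: sum_remove_pivot left_prob_def sum.distrib sum_distrib_left sum_distrib_right mult_ac
        del: sum_of_bool_eq sum_of_bool_mult_eq)
  also have "\<dots> = p * (1 - p) * (real r * (real r - 1) / 2 + (real n - 1 - real r) * (real n - 2 - real r) / 2)
     + p\<^sup>2 * real r * (real n - 1 - real r)"
    unfolding sum_less_pairs k by (simp add: power2_eq_square algebra_simps)
  finally show ?thesis .
qed

lemma card_left_deviation:
  "coinE (\<lambda>w. \<bar>real (card (left w)) - (real r * (1 - p) + (real n - 1 - real r) * p)\<bar>) \<le> sqrt (real n)"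
proof -
  have "coinE (\<lambda>w. \<bar>real (card (left w)) - coinE (\<lambda>w. real (card (left w)))\<bar>) \<le> sqrt (real (card others)) * 1"
  proof (rule coins_deviation_le)
    fix w :: "nat \<Rightarrow> bool" and a b c assume a: "a \<in> others"
    have "real (card (left (w(a := b)))) - real (card (left (w(a := c)))) =
       (\<Sum>y\<in>others. goes_left r (w(a := b)) y - goes_left r (w(a := c)) y)"
      by (simp add: card_left_part sum_subtractf)
    moreover have "\<bar>\<Sum>y\<in>others. goes_left r (w(a := b)) y - goes_left r (w(a := c)) y\<bar>
       \<le> (\<Sum>y\<in>others. of_bool (y = a))"
      by (intro order_trans[OF sum_abs] sum_mono) (auto simp: goes_left_def)
    moreover have "(\<Sum>y\<in>others. of_bool (y = a) :: real) = 1"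
      using a by (simp add: of_bool_def del: sum_of_bool_eq)
    ultimately show "\<bar>real (card (left (w(a := b)))) - real (card (left (w(a := c))))\<bar> \<le> 1"
      by simp
  qed (use p in auto)
  also have "\<dots> \<le> sqrt (real n)" by (simp add: card_others)
  finally show ?thesis unfolding expectation_card_left .
qed

text \<open>
  Changing one coin moves one element across the pivot, which affects at most the \<open>2 * n\<close> ordered
  pairs that contain this element.
\<close>

lemma cross_deviation:
  "coinE (\<lambda>w. \<bar>real (cross_inversions (left w) (right w)) - coinE (\<lambda>w. real (cross_inversions (left w) (right w)))\<bar>)
     \<le> sqrt (real n) * (2 * real n)"
proof -
  have "coinE (\<lambda>w. \<bar>real (cross_inversions (left w) (right w)) - coinE (\<lambda>w. real (cross_inversions (left w) (right w)))\<bar>)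
     \<le> sqrt (real (card others)) * (2 * real n)"
  proof (rule coins_deviation_le)
    fix w :: "nat \<Rightarrow> bool" and y b c assume y: "y \<in> others"
    let ?t = "\<lambda>w a b. of_bool (b < a) * (goes_left r w a * (1 - goes_left r w b))"
    have eq: "real (cross_inversions (left (w(y := b))) (right (w(y := b)))) - real (cross_inversions (left (w(y := c))) (right (w(y := c)))) =
       (\<Sum>i\<in>others. \<Sum>j\<in>others. ?t (w(y := b)) i j - ?t (w(y := c)) i j)"
      by (simp add: cross_inversions_left_part sum_subtractf)
    have "\<bar>\<Sum>i\<in>others. \<Sum>j\<in>others. ?t (w(y := b)) i j - ?t (w(y := c)) i j\<bar>
       \<le> (\<Sum>i\<in>others. \<Sum>j\<in>others. of_bool (i = y) + of_bool (j = y))"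
      by (intro order_trans[OF sum_abs] sum_mono) (auto simp: goes_left_def)
    also have "\<dots> = (\<Sum>i\<in>others. of_bool (i = y) * real (card others)) + (\<Sum>i\<in>others. \<Sum>j\<in>others. of_bool (j = y))"
      by (simp add: sum.distrib mult.commute del: sum_of_bool_eq)
    also have "\<dots> = 2 * real (card others)"
    proof -
      have "(\<Sum>i\<in>others. of_bool (i = y) :: real) = 1"
        using y by (simp add: of_bool_def del: sum_of_bool_eq)
      then show ?thesis by (simp only: sum_distrib_right[symmetric]) simp
    qed
    also have "\<dots> \<le> 2 * real n" by (simp add: card_others)
    finally show "\<bar>real (cross_inversions (left (w(y := b))) (right (w(y := b)))) -
        real (cross_inversions (left (w(y := c))) (right (w(y := c))))\<bar> \<le> 2 * real n"
      unfolding eq .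
  qed (use p in auto)
  also have "\<dots> \<le> sqrt (real n) * (2 * real n)"
    by (intro mult_right_mono) (simp_all add: card_others)
  finally show ?thesis .
qed

text \<open>
  The exact mean counts pairs of distinct elements other than the pivot, whereas \<open>toll\<close> counts all
  pairs; the difference is at most of order \<open>n\<close>.
\<close>

lemma toll_mean_diff:
  "\<bar>p * (1 - p) * (real r * (real r - 1) / 2 + (real n - 1 - real r) * (real n - 2 - real r) / 2)
     + p\<^sup>2 * real r * (real n - 1 - real r) - (real n)\<^sup>2 * p * toll p (real r / real n)\<bar> \<le> 3 * real n * p"
proof -
  define k where "k = real n - real r"
  have n: "real n = real r + k" "0 < real n" and k: "0 < k" using r by (auto simp: k_def)
  have toll_r: "(real n)\<^sup>2 * toll p (real r / real n) = (1 - p) / 2 * ((real r)\<^sup>2 + k\<^sup>2) + p * real r * k"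
  proof -
    have scale: "(real n)\<^sup>2 * toll p u = (1 - p) / 2 * ((real n * u)\<^sup>2 + (real n * (1 - u))\<^sup>2)
        + p * (real n * u) * (real n * (1 - u))" for u
      by (simp add: toll_def power2_eq_square algebra_simps)
    have "real n * (real r / real n) = real r" "real n * (1 - real r / real n) = k"
      using n(2) by (simp_all add: k_def right_diff_distrib)
    then show ?thesis by (simp only: scale)
  qed
  have "p * (1 - p) * (real r * (real r - 1) / 2 + (real n - 1 - real r) * (real n - 2 - real r) / 2)
     + p\<^sup>2 * real r * (real n - 1 - real r) - (real n)\<^sup>2 * p * toll p (real r / real n) =
     - p * ((1 - p) / 2 * (real r + 3 * k - 2) + p * real r)"
    unfolding mult.commute[of "(real n)\<^sup>2" p] mult.assoc[of p "(real n)\<^sup>2"] toll_r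
    by (simp add: k_def power2_eq_square field_simps)
  moreover have "\<bar>(1 - p) / 2 * (real r + 3 * k - 2) + p * real r\<bar> \<le> 3 * real n"
  proof -
    have "k \<ge> 1" using r by (simp add: k_def)
    then have k3: "\<bar>real r + 3 * k - 2\<bar> \<le> 3 * real n" using n by auto
    have "\<bar>(1 - p) / 2 * (real r + 3 * k - 2)\<bar> \<le> (1 - p) * (3 * real n)"
      unfolding abs_mult using k3 p by (intro mult_mono) auto
    moreover have "\<bar>p * real r\<bar> \<le> p * (3 * real n)"
      unfolding abs_mult using p n k by (intro mult_mono) auto
    ultimately show ?thesis by (simp add: algebra_simps)
  qed
  ultimately show ?thesis
    using p by (simp add: abs_mult mult.commute)
qed

text \<open>
  The fluctuations of the inversions between the sublists are of order \<open>n * sqrt n\<close>. They dominate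
  the at most \<open>2 * n\<close> inversions with the pivot and the error \<open>3 * n * p\<close> of the mean.
\<close>

lemma toll_deviation:
  "coinE (\<lambda>w. \<bar>real (toll_inversions r (left w) (right w)) / ((real n)\<^sup>2 * p) - toll p (real r / real n)\<bar>)
     \<le> 7 / (p * sqrt (real n))"
proof -
  define c where "c w = real (cross_inversions (left w) (right w))" for w
  define T where "T = (real n)\<^sup>2 * p * toll p (real r / real n)"
  have n: "0 < real n" "1 \<le> real n" using r by auto
  \<comment> \<open>\<open>3 * n * p\<close> is the error of the mean, \<open>2 * n\<close> bounds the inversions with the pivot.\<close>
  have ineq: "\<bar>real (toll_inversions r (left w) (right w)) - T\<bar> \<le> \<bar>c w - coinE c\<bar> + (3 * real n * p + 2 * real n)" for w
  proof -
    have "card {a \<in> left w. r < a} \<le> card {..<n}" "card {b \<in> right w. b < r} \<le> card {..<n}"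
      by (intro card_mono; auto simp: left_part_def)+
    then have "\<bar>real (toll_inversions r (left w) (right w)) - c w\<bar> \<le> 2 * real n"
      by (simp add: toll_inversions_def c_def)
    moreover have "\<bar>coinE c - T\<bar> \<le> 3 * real n * p"
      unfolding c_def[abs_def] expectation_cross T_def by (rule toll_mean_diff)
    ultimately show ?thesis by linarith
  qed
  have "coinE (\<lambda>w. \<bar>real (toll_inversions r (left w) (right w)) - T\<bar>) \<le> coinE (\<lambda>w. \<bar>c w - coinE c\<bar> + (3 * real n * p + 2 * real n))"
    using ineq by (intro integral_mono) auto
  also have "\<dots> = coinE (\<lambda>w. \<bar>c w - coinE c\<bar>) + (3 * real n * p + 2 * real n)"
    by simp
  also have "\<dots> \<le> sqrt (real n) * (2 * real n) + (3 * real n * p + 2 * real n)"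
    unfolding c_def[abs_def] by (intro add_right_mono cross_deviation)
  also have "\<dots> \<le> sqrt (real n) * (2 * real n) + 5 * (sqrt (real n) * real n)"
  proof -
    have "3 * real n * p \<le> 3 * real n" using p by (simp add: mult_left_le)
    moreover have "1 * real n \<le> sqrt (real n) * real n" using n by (intro mult_right_mono) auto
    ultimately show ?thesis by linarith
  qed
  also have "\<dots> = 7 * real n * sqrt (real n)" by simp
  finally have le: "coinE (\<lambda>w. \<bar>real (toll_inversions r (left w) (right w)) - T\<bar>) \<le> 7 * real n * sqrt (real n)" .
  have "\<bar>real (toll_inversions r (left w) (right w)) / ((real n)\<^sup>2 * p) - toll p (real r / real n)\<bar> =
     \<bar>real (toll_inversions r (left w) (right w)) - T\<bar> / ((real n)\<^sup>2 * p)" for w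
  proof -
    have "real (toll_inversions r (left w) (right w)) / ((real n)\<^sup>2 * p) - toll p (real r / real n) =
       (real (toll_inversions r (left w) (right w)) - T) / ((real n)\<^sup>2 * p)"
      unfolding T_def using n p by (simp add: field_simps)
    then show ?thesis using p by (simp add: abs_mult)
  qed
  then have "coinE (\<lambda>w. \<bar>real (toll_inversions r (left w) (right w)) / ((real n)\<^sup>2 * p) - toll p (real r / real n)\<bar>) =
     coinE (\<lambda>w. \<bar>real (toll_inversions r (left w) (right w)) - T\<bar>) / ((real n)\<^sup>2 * p)"
    by simp
  also have "\<dots> \<le> 7 * real n * sqrt (real n) / ((real n)\<^sup>2 * p)"
    using le p by (intro divide_right_mono) auto
  also have "\<dots> = 7 / (p * sqrt (real n))"
    using n p by (simp add: field_simps power2_eq_square)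
  finally show ?thesis .
qed

lemma left_size_deviation:
  "coinE (\<lambda>w. \<bar>real (card (left w)) / real n - share p (real r / real n)\<bar>) \<le> 2 / sqrt (real n)"
proof -
  define m where "m = real r * (1 - p) + (real n - 1 - real r) * p"
  have n: "0 < real n" "1 \<le> real n" using r by auto
  have "\<bar>real (card (left w)) / real n - share p (real r / real n)\<bar> \<le> (\<bar>real (card (left w)) - m\<bar> + 1) / real n" for w
  proof -
    have eq: "real (card (left w)) / real n - share p (real r / real n) = ((real (card (left w)) - m) - p) / real n"
      using n by (simp add: m_def share_def field_simps)
    show ?thesis
      unfolding eq abs_divide using n p by (simp add: divide_right_mono)
  qed
  then have "coinE (\<lambda>w. \<bar>real (card (left w)) / real n - share p (real r / real n)\<bar>) \<le>
      coinE (\<lambda>w. (\<bar>real (card (left w)) - m\<bar> + 1) / real n)"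
    by (intro integral_mono) auto
  also have "\<dots> = (coinE (\<lambda>w. \<bar>real (card (left w)) - m\<bar>) + 1) / real n"
    by simp
  also have "\<dots> \<le> (sqrt (real n) + sqrt (real n)) / real n"
    using card_left_deviation n unfolding m_def by (intro divide_right_mono add_mono) auto
  also have "\<dots> = 2 / sqrt (real n)"
    using n by (simp add: field_simps flip: power2_eq_square)
  finally show ?thesis .
qed

end

context
  fixes p c :: real and n r :: nat
  assumes p: "0 < p" "p \<le> 1" and r: "r < n"
begin

lemma rank_bounds: "0 \<le> real r / real n" "real r / real n \<le> 1"
  using r by auto

lemma expectation_triangle:
  fixes f :: "(nat \<Rightarrow> bool) \<Rightarrow> real"
  assumes "coinE p n r (\<lambda>w. \<bar>f w - a\<bar>) \<le> e" "\<bar>a - b\<bar> \<le> d"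
  shows "coinE p n r (\<lambda>w. \<bar>f w - b\<bar>) \<le> e + d"
proof -
  have "coinE p n r (\<lambda>w. \<bar>f w - b\<bar>) \<le> coinE p n r (\<lambda>w. \<bar>f w - a\<bar> + d)"
  proof (intro integral_mono)
    show "\<bar>f w - b\<bar> \<le> \<bar>f w - a\<bar> + d" for w using assms(2) by linarith
  qed auto
  also have "\<dots> = coinE p n r (\<lambda>w. \<bar>f w - a\<bar>) + d" by simp
  finally show ?thesis using assms(1) by linarith
qed

lemma toll_deviation_from_limit:
  "coinE p n r (\<lambda>w. \<bar>real (toll_inversions r (left n r w) (right n r w)) / ((real n)\<^sup>2 * p) - toll c (real r / real n)\<bar>)
     \<le> 7 / (p * sqrt (real n)) + \<bar>p - c\<bar>"
  by (rule expectation_triangle[OF toll_deviation[OF p r] toll_diff_le[OF rank_bounds]])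

lemma left_size_deviation_from_limit:
  "coinE p n r (\<lambda>w. \<bar>real (card (left n r w)) / real n - share c (real r / real n)\<bar>) \<le> 2 / sqrt (real n) + \<bar>p - c\<bar>"
  by (rule expectation_triangle[OF left_size_deviation[OF p r] share_diff_le[OF rank_bounds]])

lemma card_left_right: "real (card (left n r w)) + real (card (right n r w)) = real n - 1"
proof -
  have "card (left n r w) + card (right n r w) = card (others n r)"
    by (subst card_Un_disjoint[symmetric]) (auto simp: left_part_def intro!: arg_cong[where f = card])
  then show ?thesis using r by (simp add: of_nat_diff flip: of_nat_add)
qed

text \<open>
  The sublists together miss only the pivot, so the estimate for the left one carries over at the cost
  of \<open>1 / n\<close>.
\<close>

lemma right_size_deviation_from_limit:
  "coinE p n r (\<lambda>w. \<bar>real (card (right n r w)) / real n - (1 - share c (real r / real n))\<bar>) \<le> 3 / sqrt (real n) + \<bar>p - c\<bar>"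
proof -
  have n: "0 < real n" "1 \<le> real n" using r by auto
  have inv: "1 / real n \<le> 1 / sqrt (real n)"
  proof -
    have "sqrt (real n) * 1 \<le> sqrt (real n) * sqrt (real n)" using n by (intro mult_left_mono) auto
    then show ?thesis using n by (intro divide_left_mono) auto
  qed
  have "\<bar>real (card (right n r w)) / real n - (1 - share c (real r / real n))\<bar> \<le>
     \<bar>real (card (left n r w)) / real n - share c (real r / real n)\<bar> + 1 / real n" for w
  proof -
    have "real (card (right n r w)) = real n - 1 - real (card (left n r w))" using card_left_right[of w] by simp
    then have "real (card (right n r w)) / real n - (1 - share c (real r / real n)) =
      - (real (card (left n r w)) / real n - share c (real r / real n)) - 1 / real n"
      using n by (simp add: diff_divide_distrib)
    moreover have "0 \<le> 1 / real n" by simp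
    ultimately show ?thesis by linarith
  qed
  then have "coinE p n r (\<lambda>w. \<bar>real (card (right n r w)) / real n - (1 - share c (real r / real n))\<bar>) \<le>
     coinE p n r (\<lambda>w. \<bar>real (card (left n r w)) / real n - share c (real r / real n)\<bar> + 1 / real n)"
    by (intro integral_mono) auto
  also have "\<dots> = coinE p n r (\<lambda>w. \<bar>real (card (left n r w)) / real n - share c (real r / real n)\<bar>) + 1 / real n"
    by simp
  finally show ?thesis
    using left_size_deviation_from_limit inv by linarith
qed

end

section \<open>The fixed point equation as a limit of averages over the pivot\<close>

text \<open>
  Averaging over the rank of the pivot is a Riemann sum for the integral over the uniform variable of
  the distributional equation; for Lipschitz functions it converges at rate \<open>1 / n\<close>.
\<close>

lemma riemann_sum_lipschitz:
  fixes h :: "real \<Rightarrow> 'b::euclidean_space"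
  assumes cont: "continuous_on UNIV h" and "0 < n"
    and lip: "\<And>u v. 0 \<le> u \<Longrightarrow> u \<le> v \<Longrightarrow> v \<le> 1 \<Longrightarrow> norm (h v - h u) \<le> K * (v - u)"
  shows "norm ((\<Sum>r<n. h (real r / real n)) /\<^sub>R real n - integral\<^sup>L unif h) \<le> K / real n"
proof -
  have K: "0 \<le> K" using order_trans[OF norm_ge_zero lip[of 0 1]] by simp
  have cont': "continuous_on S h" for S using cont by (rule continuous_on_subset) simp
  have "norm ((\<Sum>r<k. h (real r / real n)) /\<^sub>R real n - integral {0..real k / real n} h) \<le> real k * (K / (real n)\<^sup>2)"
    if "k \<le> n" for k
    using that
  proof (induction k)
    case (Suc k)
    let ?a = "real k / real n" and ?b = "real (Suc k) / real n"
    have ab: "0 \<le> ?a" "?a \<le> ?b" "?b \<le> 1" "?b - ?a = 1 / real n"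
      using Suc.prems \<open>0 < n\<close> by (auto simp: field_simps)
    have split: "integral {0..?b} h = integral {0..?a} h + integral {?a..?b} h"
      using ab by (intro Henstock_Kurzweil_Integration.integral_combine[symmetric] integrable_continuous_interval cont') auto
    have "norm (integral {?a..?b} (\<lambda>u. h ?a - h u)) \<le> (K / real n) * (?b - ?a)"
    proof (rule integral_bound)
      show "norm (h ?a - h u) \<le> K / real n" if "u \<in> {?a..?b}" for u
      proof -
        have "norm (h ?a - h u) \<le> K * (u - ?a)"
          using lip[of ?a u] that ab by (simp add: norm_minus_commute)
        also have "\<dots> \<le> K * (1 / real n)"
          using that ab K by (intro mult_left_mono) auto
        finally show ?thesis by simp
      qed
    qed (use ab in \<open>auto intro!: continuous_intros cont'\<close>)
    also have "integral {?a..?b} (\<lambda>u. h ?a - h u) = h ?a /\<^sub>R real n - integral {?a..?b} h"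
      using ab by (subst Henstock_Kurzweil_Integration.integral_diff) (auto intro!: integrable_continuous_interval cont' simp: divide_inverse)
    finally have b1: "norm (h ?a /\<^sub>R real n - integral {?a..?b} h) \<le> K / (real n)\<^sup>2"
      unfolding ab(4) by (simp add: power2_eq_square)
    have b2: "norm ((\<Sum>r<k. h (real r / real n)) /\<^sub>R real n - integral {0..?a} h) \<le> real k * (K / (real n)\<^sup>2)"
      using Suc by simp
    have decomp: "(\<Sum>r<Suc k. h (real r / real n)) /\<^sub>R real n - integral {0..?b} h =
       ((\<Sum>r<k. h (real r / real n)) /\<^sub>R real n - integral {0..?a} h) + (h ?a /\<^sub>R real n - integral {?a..?b} h)"
      unfolding split by (simp add: scaleR_add_right)
    have "real (Suc k) * (K / (real n)\<^sup>2) = real k * (K / (real n)\<^sup>2) + K / (real n)\<^sup>2"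
      by (simp add: distrib_right add_divide_distrib)
    then show ?case
      unfolding decomp using order_trans[OF norm_triangle_ineq add_mono[OF b2 b1]] by simp
  qed simp
  from this[of n] show ?thesis
    using \<open>0 < n\<close> by (simp add: integral_unif[OF cont] power2_eq_square)
qed

locale solution =
  fixes c :: real and \<mu> :: "real measure"
  assumes c: "0 < c" "c \<le> 1" and sol: "finite_mean_solution c \<mu>"
begin

sublocale real_distribution \<mu>
  using sol by (simp add: finite_mean_solution_def)

abbreviation \<phi> :: "real \<Rightarrow> complex" where "\<phi> \<equiv> char \<mu>"

text \<open>
  A Lipschitz constant of \<open>\<phi>\<close>.
\<close>

definition m :: real where "m = expectation (\<lambda>x. \<bar>x\<bar>)"

definition integrand :: "real \<Rightarrow> real \<Rightarrow> complex" where
  "integrand t u = iexp (t * toll c u) * \<phi> (t * (share c u)\<^sup>2) * \<phi> (t * (1 - share c u)\<^sup>2)"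

lemma m_nonneg: "0 \<le> m"
  unfolding m_def by simp

lemma phi_lipschitz: "norm (\<phi> s - \<phi> t) \<le> m * \<bar>s - t\<bar>"
  using norm_char_diff_le[of s t] sol by (simp add: m_def finite_mean_solution_def mult.commute)

lemma phi_eq: "\<phi> t = integral\<^sup>L unif (integrand t)"
proof -
  have "\<phi> t = char (dist_eq_rhs c \<mu>) t" using sol by (simp add: finite_mean_solution_def)
  then show ?thesis
    unfolding integrand_def[abs_def] by (simp only: char_dist_eq_rhs[OF real_distribution_axioms])
qed

lemma phi_square_diff:
  assumes "0 \<le> a" "a \<le> 1" "0 \<le> b" "b \<le> 1"
  shows "norm (\<phi> (t * a\<^sup>2) - \<phi> (t * b\<^sup>2)) \<le> \<bar>t\<bar> * (2 * m * \<bar>a - b\<bar>)"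
proof -
  have "norm (\<phi> (t * a\<^sup>2) - \<phi> (t * b\<^sup>2)) \<le> m * \<bar>t * a\<^sup>2 - t * b\<^sup>2\<bar>"
    by (rule phi_lipschitz)
  also have "\<dots> = m * (\<bar>t\<bar> * \<bar>a\<^sup>2 - b\<^sup>2\<bar>)"
    by (simp add: abs_mult flip: right_diff_distrib)
  also have "\<dots> \<le> m * (\<bar>t\<bar> * (2 * \<bar>a - b\<bar>))"
    using m_nonneg by (intro mult_left_mono abs_square_diff_le assms) auto
  finally show ?thesis by (simp add: mult_ac)
qed

lemma continuous_integrand: "continuous_on UNIV (integrand t)"
proof -
  have "continuous_on UNIV \<phi>"
    by (intro continuous_at_imp_continuous_on ballI isCont_char)
  then have comp: "continuous_on UNIV (\<lambda>u. \<phi> (f u))" if "continuous_on UNIV f" for f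
    using continuous_on_compose2[OF _ that, of UNIV \<phi>] by simp
  show ?thesis
    unfolding integrand_def by (intro continuous_intros comp)
qed

lemma integrand_lipschitz:
  assumes "0 \<le> u" "u \<le> v" "v \<le> 1"
  shows "norm (integrand t v - integrand t u) \<le> \<bar>t\<bar> * (1 + 4 * m) * (v - u)"
proof -
  note b = share_bounds[of c u] share_bounds[of c v]
  have "norm (integrand t v - integrand t u) \<le> norm (iexp (t * toll c v) - iexp (t * toll c u)) +
     norm (\<phi> (t * (share c v)\<^sup>2) - \<phi> (t * (share c u)\<^sup>2)) + norm (\<phi> (t * (1 - share c v)\<^sup>2) - \<phi> (t * (1 - share c u)\<^sup>2))"
    unfolding integrand_def by (intro norm_mult3_diff_le cmod_char_le_1) simp
  also have "\<dots> \<le> \<bar>t\<bar> * (v - u) + \<bar>t\<bar> * (2 * m * (v - u)) + \<bar>t\<bar> * (2 * m * (v - u))"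
  proof (intro add_mono)
    have "norm (iexp (t * toll c v) - iexp (t * toll c u)) \<le> \<bar>t * toll c v - t * toll c u\<bar>"
      by (rule norm_iexp_diff_le)
    also have "\<dots> = \<bar>t\<bar> * \<bar>toll c v - toll c u\<bar>" by (simp add: abs_mult flip: right_diff_distrib)
    also have "\<dots> \<le> \<bar>t\<bar> * \<bar>v - u\<bar>" using c assms by (intro mult_left_mono toll_lipschitz) auto
    finally show "norm (iexp (t * toll c v) - iexp (t * toll c u)) \<le> \<bar>t\<bar> * (v - u)" using assms by simp
    have sh: "\<bar>share c v - share c u\<bar> \<le> v - u" using share_lipschitz[of c v u] c assms by simp
    have "norm (\<phi> (t * (share c v)\<^sup>2) - \<phi> (t * (share c u)\<^sup>2)) \<le> \<bar>t\<bar> * (2 * m * \<bar>share c v - share c u\<bar>)"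
      using b c assms by (intro phi_square_diff) auto
    also have "\<dots> \<le> \<bar>t\<bar> * (2 * m * (v - u))"
      using sh m_nonneg by (intro mult_left_mono) auto
    finally show "norm (\<phi> (t * (share c v)\<^sup>2) - \<phi> (t * (share c u)\<^sup>2)) \<le> \<bar>t\<bar> * (2 * m * (v - u))" .
    have "norm (\<phi> (t * (1 - share c v)\<^sup>2) - \<phi> (t * (1 - share c u)\<^sup>2)) \<le> \<bar>t\<bar> * (2 * m * \<bar>(1 - share c v) - (1 - share c u)\<bar>)"
      using b c assms by (intro phi_square_diff) auto
    also have "\<dots> \<le> \<bar>t\<bar> * (2 * m * (v - u))"
      using sh m_nonneg by (intro mult_left_mono) auto
    finally show "norm (\<phi> (t * (1 - share c v)\<^sup>2) - \<phi> (t * (1 - share c u)\<^sup>2)) \<le> \<bar>t\<bar> * (2 * m * (v - u))" .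
  qed
  finally show ?thesis by (simp add: algebra_simps)
qed

lemma riemann_integrand:
  assumes "0 < n"
  shows "norm ((\<Sum>r<n. integrand t (real r / real n)) / of_nat n - \<phi> t) \<le> \<bar>t\<bar> * ((1 + 4 * m) / real n)"
proof -
  have "norm ((\<Sum>r<n. integrand t (real r / real n)) /\<^sub>R real n - integral\<^sup>L unif (integrand t)) \<le> \<bar>t\<bar> * (1 + 4 * m) / real n"
    by (rule riemann_sum_lipschitz[OF continuous_integrand assms integrand_lipschitz])
  moreover have "(\<Sum>r<n. integrand t (real r / real n)) /\<^sub>R real n = (\<Sum>r<n. integrand t (real r / real n)) / of_nat n"
    by (simp add: scaleR_conv_of_real field_simps)
  ultimately show ?thesis
    unfolding phi_eq[symmetric] by simp
qed

lemma riemann_squares: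
  assumes "0 < n"
  shows "(\<Sum>r<n. (share c (real r / real n))\<^sup>2 + (1 - share c (real r / real n))\<^sup>2) / real n \<le> 2 / 3 + 4 / real n"
proof -
  let ?h = "\<lambda>u. (share c u)\<^sup>2 + (1 - share c u)\<^sup>2"
  have close: "norm ((\<Sum>r<n. ?h (real r / real n)) /\<^sub>R real n - integral\<^sup>L unif ?h) \<le> 4 / real n"
  proof (rule riemann_sum_lipschitz)
    show "continuous_on UNIV ?h" by (intro continuous_intros)
    fix u v :: real assume uv: "0 \<le> u" "u \<le> v" "v \<le> 1"
    have sh: "\<bar>share c v - share c u\<bar> \<le> v - u" using share_lipschitz[of c v u] c uv by simp
    have "\<bar>(share c v)\<^sup>2 - (share c u)\<^sup>2\<bar> \<le> 2 * (v - u)"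
      by (rule order_trans[OF abs_square_diff_le]) (use c uv sh share_bounds in auto)
    moreover have "\<bar>(1 - share c v)\<^sup>2 - (1 - share c u)\<^sup>2\<bar> \<le> 2 * (v - u)"
    proof (rule order_trans[OF abs_square_diff_le])
      show "2 * \<bar>(1 - share c v) - (1 - share c u)\<bar> \<le> 2 * (v - u)"
        using sh by (simp add: abs_minus_commute)
    qed (use c uv share_bounds[of c u] share_bounds[of c v] in auto)
    moreover have "\<bar>x + y - (x' + y')\<bar> \<le> 4 * e" if "\<bar>x - x'\<bar> \<le> 2 * e" "\<bar>y - y'\<bar> \<le> 2 * e" for x y x' y' e :: real
      using that by linarith
    ultimately show "norm (?h v - ?h u) \<le> 4 * (v - u)" unfolding real_norm_def by blast
  qed (use assms in auto)
  have "(\<Sum>r<n. ?h (real r / real n)) / real n - integral\<^sup>L unif ?h \<le> 4 / real n"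
    using close unfolding real_norm_def real_scaleR_def divide_inverse_commute[symmetric] by (rule abs_le_D1)
  moreover have "integral\<^sup>L unif ?h \<le> 2 / 3"
    using c by (intro integral_unif_squares_le) auto
  ultimately show ?thesis by linarith
qed

section \<open>Convergence\<close>

text \<open>
  One level of the recursion. Suppose that the error for sizes \<open>k < n\<close> is at most
  \<open>\<bar>s\<bar> * p * (a * k\<^sup>2 + b * k)\<close>. Compare the product inside the recursion with the integrand of the fixed point
  equation at \<open>u = r / n\<close>. The linear error term does not grow, because the sizes of the two sublists add up
  to \<open>n - 1\<close>. The quadratic one is multiplied by a factor that tends to the contraction factor. All other
  errors are at most multiples of \<open>\<bar>s\<bar> * p * n\<^sup>2 * \<alpha>\<close>, where \<open>\<alpha>\<close> is the order of the mean deviations of the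
  relative sizes and of the toll from their limits.
\<close>

lemma one_step:
  assumes p: "0 < p" "p \<le> 1" and n: "0 < n" and "0 \<le> a" "0 \<le> b"
    and IH: "\<And>k s. k < n \<Longrightarrow> norm (err_char p k s - \<phi> (s * p * (real k)\<^sup>2)) \<le> \<bar>s\<bar> * p * (a * (real k)\<^sup>2 + b * real k)"
  defines "\<alpha> \<equiv> 1 / sqrt (real n) + \<bar>p - c\<bar>"
  shows "norm (err_char p n s - \<phi> (s * p * (real n)\<^sup>2)) \<le>
    \<bar>s\<bar> * p * ((real n)\<^sup>2 * ((7 / p + 2 + 14 * m) * \<alpha> + a * (2 / 3 + 14 * \<alpha>)) + b * real n)"
proof -
  define t where "t = s * p * (real n)\<^sup>2"
  define V where "V r = share c (real r / real n)" for r
  define Q where "Q r = (V r)\<^sup>2 + (1 - V r)\<^sup>2" for r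
  define X where "X r w = iexp (s * real (toll_inversions r (left n r w) (right n r w))) *
      err_char p (card (left n r w)) s * err_char p (card (right n r w)) s" for r w
  define D0 where "D0 r w = \<bar>real (toll_inversions r (left n r w) (right n r w)) / ((real n)\<^sup>2 * p) - toll c (real r / real n)\<bar>" for r w
  define D1 where "D1 r w = \<bar>real (card (left n r w)) / real n - V r\<bar>" for r w
  define D2 where "D2 r w = \<bar>real (card (right n r w)) / real n - (1 - V r)\<bar>" for r w
  have n0: "0 < real n" "1 \<le> real n" using n by auto
  have abs_t: "\<bar>t\<bar> = \<bar>s\<bar> * p * (real n)\<^sup>2" using p by (simp add: t_def abs_mult)
  have inv: "1 / real n \<le> 1 / sqrt (real n)"
  proof -
    have "sqrt (real n) * 1 \<le> sqrt (real n) * sqrt (real n)" using n0 by (intro mult_left_mono) auto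
    then show ?thesis using n0 by (intro divide_left_mono) auto
  qed
  have \<alpha>: "0 \<le> \<alpha>" "1 / sqrt (real n) \<le> \<alpha>" "1 / real n \<le> \<alpha>" "\<bar>p - c\<bar> \<le> \<alpha>"
    using inv n0 by (auto simp: \<alpha>_def)
  \<comment> \<open>The comparison for a fixed pivot \<open>r\<close> and fixed coins \<open>w\<close>.\<close>
  have pointwise: "norm (X r w - integrand t (real r / real n)) \<le>
     \<bar>s\<bar> * p * ((real n)\<^sup>2 * (D0 r w + (2 * m + 2 * a) * (D1 r w + D2 r w) + a * Q r) + b * real n)"
    if r: "r < n" for r w
  proof -
    define N1 where "N1 = card (left n r w)"
    define N2 where "N2 = card (right n r w)"
    have N: "real N1 + real N2 = real n - 1"
      unfolding N1_def N2_def by (rule card_left_right[OF p r])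
    then have N_le: "N1 < n" "N2 < n" "real N1 / real n \<le> 1" "real N2 / real n \<le> 1"
      using n0 by (auto simp: divide_le_eq)
    have V01: "0 \<le> V r" "V r \<le> 1"
      using share_bounds[of c "real r / real n"] c r by (auto simp: V_def)
    \<comment> \<open>The induction hypothesis, transported from the actual relative size of a sublist to its limit \<open>v\<close>.\<close>
    have part: "norm (err_char p k s - \<phi> (t * v\<^sup>2)) \<le>
        \<bar>s\<bar> * p * (a * (real k)\<^sup>2 + b * real k) + \<bar>t\<bar> * (2 * m * \<bar>real k / real n - v\<bar>)"
      if "k < n" "0 \<le> v" "v \<le> 1" for k v
    proof -
      have "s * p * (real k)\<^sup>2 = t * (real k / real n)\<^sup>2"
        using n0 by (simp add: t_def power_divide)
      then have 1: "norm (err_char p k s - \<phi> (t * (real k / real n)\<^sup>2)) \<le> \<bar>s\<bar> * p * (a * (real k)\<^sup>2 + b * real k)"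
        using IH[OF that(1), of s] by simp
      have 2: "norm (\<phi> (t * (real k / real n)\<^sup>2) - \<phi> (t * v\<^sup>2)) \<le> \<bar>t\<bar> * (2 * m * \<bar>real k / real n - v\<bar>)"
        using that n0 by (intro phi_square_diff) auto
      show ?thesis
        by (rule norm_diff_triangle_le[OF 1 2])
    qed
    have toll_part: "norm (iexp (s * real (toll_inversions r (left n r w) (right n r w))) - iexp (t * toll c (real r / real n))) \<le> \<bar>t\<bar> * D0 r w"
    proof -
      have "s * real (toll_inversions r (left n r w) (right n r w)) = t * (real (toll_inversions r (left n r w) (right n r w)) / ((real n)\<^sup>2 * p))"
        using n0 p by (simp add: t_def)
      then have "\<bar>s * real (toll_inversions r (left n r w) (right n r w)) - t * toll c (real r / real n)\<bar> = \<bar>t\<bar> * D0 r w"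
        by (simp only: D0_def abs_mult flip: right_diff_distrib)
      then show ?thesis
        using norm_iexp_diff_le[of "s * real (toll_inversions r (left n r w) (right n r w))" "t * toll c (real r / real n)"] by linarith
    qed
    have "norm (X r w - integrand t (real r / real n)) \<le>
       norm (iexp (s * real (toll_inversions r (left n r w) (right n r w))) - iexp (t * toll c (real r / real n))) +
       norm (err_char p N1 s - \<phi> (t * (V r)\<^sup>2)) + norm (err_char p N2 s - \<phi> (t * (1 - V r)\<^sup>2))"
      unfolding X_def integrand_def N1_def N2_def V_def
      by (intro norm_mult3_diff_le cmod_err_char_le_1 cmod_char_le_1) simp
    also have "\<dots> \<le> \<bar>t\<bar> * D0 r w + (\<bar>s\<bar> * p * (a * (real N1)\<^sup>2 + b * real N1) + \<bar>t\<bar> * (2 * m * D1 r w))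
       + (\<bar>s\<bar> * p * (a * (real N2)\<^sup>2 + b * real N2) + \<bar>t\<bar> * (2 * m * D2 r w))"
      using part[OF N_le(1), of "V r"] part[OF N_le(2), of "1 - V r"] V01 toll_part
      by (intro add_mono) (auto simp: D1_def D2_def N1_def N2_def)
    also have "\<dots> = \<bar>s\<bar> * p * ((real n)\<^sup>2 * (D0 r w + 2 * m * (D1 r w + D2 r w)) + a * ((real N1)\<^sup>2 + (real N2)\<^sup>2) + b * (real N1 + real N2))"
      unfolding abs_t by (simp add: algebra_simps)
    also have "\<dots> \<le> \<bar>s\<bar> * p * ((real n)\<^sup>2 * (D0 r w + 2 * m * (D1 r w + D2 r w)) + a * ((real n)\<^sup>2 * (Q r + 2 * (D1 r w + D2 r w))) + b * real n)"
    proof -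
      have sq: "(real k)\<^sup>2 \<le> (real n)\<^sup>2 * (v\<^sup>2 + 2 * \<bar>real k / real n - v\<bar>)"
        if "real k / real n \<le> 1" "0 \<le> v" "v \<le> 1" for k v
      proof -
        have "\<bar>(real k / real n)\<^sup>2 - v\<^sup>2\<bar> \<le> 2 * \<bar>real k / real n - v\<bar>"
          by (rule abs_square_diff_le) (use that in auto)
        then have "(real k / real n)\<^sup>2 \<le> v\<^sup>2 + 2 * \<bar>real k / real n - v\<bar>"
          by (simp only: abs_le_iff) simp
        then have "(real n)\<^sup>2 * (real k / real n)\<^sup>2 \<le> (real n)\<^sup>2 * (v\<^sup>2 + 2 * \<bar>real k / real n - v\<bar>)"
          by (rule mult_left_mono) simp
        then show ?thesis using n0 by (simp add: power_divide)
      qed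
      have "(real N1)\<^sup>2 + (real N2)\<^sup>2 \<le> (real n)\<^sup>2 * ((V r)\<^sup>2 + 2 * D1 r w) + (real n)\<^sup>2 * ((1 - V r)\<^sup>2 + 2 * D2 r w)"
        using sq[OF N_le(3), of "V r"] sq[OF N_le(4), of "1 - V r"] V01
        by (intro add_mono) (auto simp: D1_def D2_def N1_def N2_def)
      also have "\<dots> = (real n)\<^sup>2 * (Q r + 2 * (D1 r w + D2 r w))"
        unfolding Q_def by (simp add: algebra_simps)
      finally show ?thesis
        using N p m_nonneg \<open>0 \<le> a\<close> \<open>0 \<le> b\<close> by (intro mult_left_mono add_mono) auto
    qed
    also have "\<dots> = \<bar>s\<bar> * p * ((real n)\<^sup>2 * (D0 r w + (2 * m + 2 * a) * (D1 r w + D2 r w) + a * Q r) + b * real n)"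
      by (simp add: algebra_simps)
    finally show ?thesis .
  qed
  \<comment> \<open>Averaged over the coins, each deviation is at most a multiple of \<open>\<alpha>\<close>.\<close>
  have mean: "norm (coinE p n r (X r) - integrand t (real r / real n)) \<le>
     \<bar>s\<bar> * p * ((real n)\<^sup>2 * ((7 / p + 1) * \<alpha> + (2 * m + 2 * a) * (5 * \<alpha>) + a * Q r) + b * real n)"
    if r: "r < n" for r
  proof -
    have eq: "coinE p n r (X r) - integrand t (real r / real n) = coinE p n r (\<lambda>w. X r w - integrand t (real r / real n))"
      by (subst Bochner_Integration.integral_diff) auto
    have "norm (coinE p n r (X r) - integrand t (real r / real n)) \<le> coinE p n r (\<lambda>w. norm (X r w - integrand t (real r / real n)))"
      unfolding eq by (rule integral_norm_bound)
    also have "\<dots> \<le> coinE p n r (\<lambda>w. \<bar>s\<bar> * p * ((real n)\<^sup>2 * (D0 r w + (2 * m + 2 * a) * (D1 r w + D2 r w) + a * Q r) + b * real n))"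
      by (intro integral_mono pointwise r) auto
    also have "\<dots> = \<bar>s\<bar> * p * ((real n)\<^sup>2 * (coinE p n r (D0 r) + (2 * m + 2 * a) * (coinE p n r (D1 r) + coinE p n r (D2 r)) + a * Q r) + b * real n)"
      by simp
    also have "\<dots> \<le> \<bar>s\<bar> * p * ((real n)\<^sup>2 * ((7 / p + 1) * \<alpha> + (2 * m + 2 * a) * (5 * \<alpha>) + a * Q r) + b * real n)"
    proof -
      have "coinE p n r (D0 r) \<le> 7 / p * (1 / sqrt (real n)) + \<bar>p - c\<bar>"
        using toll_deviation_from_limit[OF p r, of c] unfolding D0_def by simp
      also have "\<dots> \<le> 7 / p * \<alpha> + \<alpha>"
        using p \<alpha> by (intro add_mono mult_left_mono) auto
      finally have 0: "coinE p n r (D0 r) \<le> (7 / p + 1) * \<alpha>" by (simp add: distrib_right)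
      have le1: "coinE p n r (D1 r) \<le> 2 * (1 / sqrt (real n)) + \<bar>p - c\<bar>"
        using left_size_deviation_from_limit[OF p r, of c] unfolding D1_def V_def by simp
      have le2: "coinE p n r (D2 r) \<le> 3 * (1 / sqrt (real n)) + \<bar>p - c\<bar>"
        using right_size_deviation_from_limit[OF p r, of c] unfolding D2_def V_def by simp
      have 12: "coinE p n r (D1 r) + coinE p n r (D2 r) \<le> 5 * \<alpha>"
      proof -
        have "x + y \<le> 5 * (d + e)" if "x \<le> 2 * d + e" "y \<le> 3 * d + e" "0 \<le> e" for x y d e :: real
          using that by argo
        from this[OF le1 le2 abs_ge_zero] show ?thesis unfolding \<alpha>_def .
      qed
      show ?thesis
        using 0 12 p m_nonneg \<open>0 \<le> a\<close> \<open>0 \<le> b\<close> by (intro mult_left_mono add_mono) auto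
    qed
    finally show ?thesis .
  qed
  \<comment> \<open>Averaging over the pivot turns \<open>Q\<close> and the integrand into Riemann sums.\<close>
  have rec: "err_char p n s = (\<Sum>r<n. coinE p n r (X r)) / of_nat n"
    unfolding err_char_rec[OF n] X_def[abs_def] Let_def ..
  let ?I = "(\<Sum>r<n. integrand t (real r / real n)) / of_nat n"
  define c0 where "c0 = (7 / p + 1) * \<alpha> + (2 * m + 2 * a) * (5 * \<alpha>)"
  have diff: "err_char p n s - ?I = (\<Sum>r<n. coinE p n r (X r) - integrand t (real r / real n)) / of_nat n"
    unfolding rec by (simp add: sum_subtractf diff_divide_distrib)
  have "norm (err_char p n s - ?I) \<le> (\<Sum>r<n. \<bar>s\<bar> * p * ((real n)\<^sup>2 * (c0 + a * Q r) + b * real n)) / real n"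
  proof -
    have "norm (\<Sum>r<n. coinE p n r (X r) - integrand t (real r / real n)) \<le> (\<Sum>r<n. \<bar>s\<bar> * p * ((real n)\<^sup>2 * (c0 + a * Q r) + b * real n))"
      unfolding c0_def by (rule sum_norm_le) (use mean in auto)
    then show ?thesis
      unfolding diff norm_divide norm_of_nat by (intro divide_right_mono) auto
  qed
  also have "\<dots> = \<bar>s\<bar> * p * ((real n)\<^sup>2 * (c0 + a * ((\<Sum>r<n. Q r) / real n)) + b * real n)"
  proof -
    have "(\<Sum>r<n. \<bar>s\<bar> * p * ((real n)\<^sup>2 * (c0 + a * Q r) + b * real n)) =
        \<bar>s\<bar> * p * ((real n)\<^sup>2 * (real n * c0 + a * (\<Sum>r<n. Q r)) + b * real n * real n)"
      by (simp add: sum.distrib sum_distrib_left algebra_simps)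
    then show ?thesis using n0 by (simp only:) (simp add: field_simps)
  qed
  also have "\<dots> \<le> \<bar>s\<bar> * p * ((real n)\<^sup>2 * (c0 + a * (2 / 3 + 4 * \<alpha>)) + b * real n)"
  proof -
    have "(\<Sum>r<n. Q r) / real n \<le> 2 / 3 + 4 * (1 / real n)"
      using riemann_squares[OF n] unfolding Q_def V_def by simp
    also have "\<dots> \<le> 2 / 3 + 4 * \<alpha>" using \<alpha> by simp
    finally show ?thesis
      using p \<open>0 \<le> a\<close> \<open>0 \<le> b\<close> by (intro mult_left_mono add_mono) auto
  qed
  finally have 1: "norm (err_char p n s - ?I) \<le> \<bar>s\<bar> * p * ((real n)\<^sup>2 * (c0 + a * (2 / 3 + 4 * \<alpha>)) + b * real n)" .
  have "norm (?I - \<phi> t) \<le> \<bar>t\<bar> * ((1 + 4 * m) * (1 / real n))"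
    using riemann_integrand[OF n, of t] by simp
  also have "\<dots> \<le> \<bar>t\<bar> * ((1 + 4 * m) * \<alpha>)"
    using m_nonneg \<alpha> by (intro mult_left_mono) auto
  finally have 2: "norm (?I - \<phi> t) \<le> \<bar>t\<bar> * ((1 + 4 * m) * \<alpha>)" .
  have "norm (err_char p n s - \<phi> t) \<le> \<bar>s\<bar> * p * ((real n)\<^sup>2 * (c0 + a * (2 / 3 + 4 * \<alpha>)) + b * real n) + \<bar>t\<bar> * ((1 + 4 * m) * \<alpha>)"
    by (rule norm_diff_triangle_le[OF 1 2])
  also have "\<dots> = \<bar>s\<bar> * p * ((real n)\<^sup>2 * ((7 / p + 2 + 14 * m) * \<alpha> + a * (2 / 3 + 14 * \<alpha>)) + b * real n)"
    unfolding abs_t c0_def by (simp add: algebra_simps)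
  finally show ?thesis unfolding t_def .
qed

text \<open>
  The linear term absorbs the sizes below \<open>M\<close>, for which \<open>one_step\<close> has no small error and only the
  trivial bound is available. From \<open>M\<close> on, the factor of \<open>4 * \<eta>\<close> in the quadratic term is at most
  \<open>2 / 3 + 14 / 168 = 3 / 4\<close>, and the new errors contribute at most the remaining \<open>\<eta>\<close>.
\<close>

lemma err_char_approx:
  assumes p: "0 < p" "p \<le> 1" "c / 2 \<le> p" and \<eta>: "0 < \<eta>" and M: "0 < M"
    and \<alpha>: "\<alpha> \<le> 1 / 168" "(14 / c + 2 + 14 * m) * \<alpha> \<le> \<eta>" "1 / sqrt (real M) + \<bar>p - c\<bar> \<le> \<alpha>"
  shows "norm (err_char p n s - \<phi> (s * p * (real n)\<^sup>2)) \<le>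
           \<bar>s\<bar> * p * (4 * \<eta> * (real n)\<^sup>2 + (2 / c + m) * real M * real n)"
proof (induction n arbitrary: s rule: less_induct)
  case (less n)
  have C0: "0 \<le> 2 / c + m" using c m_nonneg by simp
  have inv_p: "1 / p \<le> 2 / c" using p c by (simp add: field_simps)
  show ?case
  proof (cases "n < M")
    case True
    have 1: "norm (err_char p n s - 1) \<le> \<bar>s\<bar> * (real n)\<^sup>2" by (rule norm_err_char_minus_1_le)
    have "norm (1 - \<phi> (s * p * (real n)\<^sup>2)) \<le> m * \<bar>0 - s * p * (real n)\<^sup>2\<bar>"
      using phi_lipschitz[of 0 "s * p * (real n)\<^sup>2"] by (simp only: char_zero)
    also have "\<dots> = \<bar>s\<bar> * p * (real n)\<^sup>2 * m" using p by (simp add: abs_mult)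
    finally have 2: "norm (1 - \<phi> (s * p * (real n)\<^sup>2)) \<le> \<bar>s\<bar> * p * (real n)\<^sup>2 * m" .
    have "norm (err_char p n s - \<phi> (s * p * (real n)\<^sup>2)) \<le> \<bar>s\<bar> * (real n)\<^sup>2 + \<bar>s\<bar> * p * (real n)\<^sup>2 * m"
      by (rule norm_diff_triangle_le[OF 1 2])
    also have "\<dots> = \<bar>s\<bar> * p * ((1 / p + m) * real n * real n)"
      using p by (simp add: field_simps power2_eq_square)
    also have "\<dots> \<le> \<bar>s\<bar> * p * ((2 / c + m) * real M * real n)"
      using True p C0 m_nonneg inv_p by (intro mult_left_mono mult_right_mono mult_mono) auto
    also have "\<dots> \<le> \<bar>s\<bar> * p * (4 * \<eta> * (real n)\<^sup>2 + (2 / c + m) * real M * real n)"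
      using p \<eta> by (intro mult_left_mono) auto
    finally show ?thesis .
  next
    case False
    then have n: "0 < n" "M \<le> n" using M by auto
    define \<beta> where "\<beta> = 1 / sqrt (real n) + \<bar>p - c\<bar>"
    have "1 / sqrt (real n) \<le> 1 / sqrt (real M)"
      using n M by (intro divide_left_mono) auto
    then have \<beta>: "\<beta> \<le> \<alpha>" "0 \<le> \<beta>" using \<alpha>(3) by (auto simp: \<beta>_def)
    have C: "0 \<le> (2 / c + m) * real M" using C0 by simp
    have "norm (err_char p n s - \<phi> (s * p * (real n)\<^sup>2)) \<le>
      \<bar>s\<bar> * p * ((real n)\<^sup>2 * ((7 / p + 2 + 14 * m) * \<beta> + 4 * \<eta> * (2 / 3 + 14 * \<beta>)) + (2 / c + m) * real M * real n)"
      unfolding \<beta>_def using p n \<eta> C less by (intro one_step) auto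
    also have "\<dots> \<le> \<bar>s\<bar> * p * ((real n)\<^sup>2 * (4 * \<eta>) + (2 / c + m) * real M * real n)"
    proof -
      have "(7 / p + 2 + 14 * m) * \<beta> \<le> (14 / c + 2 + 14 * m) * \<alpha>"
        using \<beta> inv_p m_nonneg c by (intro mult_mono) auto
      moreover have "4 * \<eta> * (2 / 3 + 14 * \<beta>) \<le> 4 * \<eta> * (3 / 4)"
        using \<beta> \<alpha>(1) \<eta> by (intro mult_left_mono) auto
      ultimately have "(7 / p + 2 + 14 * m) * \<beta> + 4 * \<eta> * (2 / 3 + 14 * \<beta>) \<le> 4 * \<eta>"
        using \<alpha>(2) by linarith
      then show ?thesis
        using p by (intro mult_left_mono add_right_mono) auto
    qed
    finally show ?thesis by (simp add: mult.commute)
  qed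
qed

text \<open>
  For \<open>s * p * n\<^sup>2 = t\<close> the bound of \<open>err_char_approx\<close> becomes
  \<open>\<bar>t\<bar> * (4 * \<eta> + (2 / c + m) * M / n)\<close>; choose \<open>\<eta>\<close>, then \<open>M\<close>, then \<open>n\<close>.
\<close>

lemma char_normalized_tendsto:
  assumes n: "filterlim n at_top sequentially" and p: "\<And>k. 0 < p k \<and> p k \<le> 1" and lim: "p \<longlonglongrightarrow> c"
  shows "(\<lambda>k. char (normalized_err_inversions (n k) (p k)) t) \<longlonglongrightarrow> \<phi> t"
proof (rule LIMSEQ_I)
  fix e :: real assume e: "0 < e"
  define \<eta> where "\<eta> = e / (8 * (\<bar>t\<bar> + 1))"
  have \<eta>: "0 < \<eta>" using e by (simp add: \<eta>_def)
  define K where "K = 14 / c + 2 + 14 * m"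
  have K: "0 < K" using c m_nonneg by (simp add: K_def add_pos_nonneg)
  define \<alpha> where "\<alpha> = min (1 / 168) (\<eta> / K)"
  have \<alpha>: "0 < \<alpha>" "\<alpha> \<le> 1 / 168" "K * \<alpha> \<le> \<eta>"
    using \<eta> K by (auto simp: \<alpha>_def min_def field_simps)
  have "\<forall>\<^sub>F M in sequentially. 1 / sqrt (real M) < \<alpha> / 2"
    using \<alpha> by (intro order_tendstoD(2)[of _ 0]) (real_asymp, simp)
  then obtain M where M: "0 < M" "1 / sqrt (real M) < \<alpha> / 2"
    using eventually_happens[OF eventually_conj[OF eventually_gt_at_top[of 0]]] by auto
  have C0: "0 \<le> 2 / c + m" using c m_nonneg by simp
  have "\<forall>\<^sub>F k in sequentially. \<bar>p k - c\<bar> < min (\<alpha> / 2) (c / 2)"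
    using tendstoD[OF lim, of "min (\<alpha> / 2) (c / 2)"] \<alpha>(1) c by (simp only: dist_real_def)
  moreover have "\<forall>\<^sub>F k in sequentially. 0 < n k"
    by (rule eventually_compose_filterlim[OF eventually_gt_at_top n])
  moreover have "\<forall>\<^sub>F k in sequentially. \<bar>t\<bar> * ((2 / c + m) * real M / real (n k)) < e / 2"
  proof (rule order_tendstoD(2))
    have real_n: "filterlim (\<lambda>k. real (n k)) at_top sequentially"
      by (rule filterlim_compose[OF filterlim_real_sequentially n])
    show "(\<lambda>k. \<bar>t\<bar> * ((2 / c + m) * real M / real (n k))) \<longlonglongrightarrow> \<bar>t\<bar> * 0"
      by (rule tendsto_mult[OF tendsto_const real_tendsto_divide_at_top[OF tendsto_const real_n]])
    show "\<bar>t\<bar> * 0 < e / 2" using e by simp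
  qed
  ultimately have "\<forall>\<^sub>F k in sequentially. norm (char (normalized_err_inversions (n k) (p k)) t - \<phi> t) < e"
  proof eventually_elim
    case (elim k)
    let ?n = "real (n k)"
    define s where "s = t / (?n\<^sup>2 * p k)"
    have pk: "0 < p k" "p k \<le> 1" "c / 2 \<le> p k" using p elim by (auto simp: abs_if split: if_splits)
    have t: "s * p k * ?n\<^sup>2 = t" using pk elim by (simp add: s_def)
    then have abs_t: "\<bar>s\<bar> * p k = \<bar>t\<bar> / ?n\<^sup>2" using pk elim by (simp add: s_def abs_mult)
    have "norm (err_char (p k) (n k) s - \<phi> t) \<le> \<bar>s\<bar> * p k * (4 * \<eta> * ?n\<^sup>2 + (2 / c + m) * real M * ?n)"
      unfolding t[symmetric] using elim M \<alpha> pk \<eta> unfolding K_def by (intro err_char_approx[of _ _ _ \<alpha>]) auto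
    also have "\<dots> = 4 * \<eta> * \<bar>t\<bar> + \<bar>t\<bar> * ((2 / c + m) * real M / ?n)"
      unfolding abs_t using elim(2) by (simp add: field_simps power2_eq_square)
    also have "\<dots> < e / 2 + e / 2"
    proof (rule add_le_less_mono)
      show "4 * \<eta> * \<bar>t\<bar> \<le> e / 2"
        using e by (simp add: \<eta>_def field_simps)
    qed (use elim in simp)
    finally show ?case
      by (simp add: char_normalized_err_inversions s_def)
  qed
  then show "\<exists>k0. \<forall>k\<ge>k0. norm (char (normalized_err_inversions (n k) (p k)) t - \<phi> t) < e"
    by (simp add: eventually_sequentially)
qed

end

theorem theorem2p1:
  fixes c :: real
  assumes "0 < c" "c \<le> 1"
  shows "\<exists>\<mu>. finite_mean_solution c \<mu> \<and> (\<forall>\<nu>. finite_mean_solution c \<nu> \<longrightarrow> \<nu> = \<mu>) \<and>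
     (\<forall>(n :: nat \<Rightarrow> nat) (p :: nat \<Rightarrow> real).
        filterlim n at_top sequentially \<longrightarrow> (\<forall>k. 0 < p k \<and> p k \<le> 1) \<longrightarrow> p \<longlonglongrightarrow> c \<longrightarrow>
        weak_conv_m (\<lambda>k. normalized_err_inversions (n k) (p k)) \<mu>) \<and>
     prob_space.expectation \<mu> (\<lambda>x. x) = (2 - c) / (2 * (1 + 2 * c - 2 * c\<^sup>2)) \<and>
     integrable \<mu> (\<lambda>x. x\<^sup>2) \<and>
     prob_space.variance \<mu> (\<lambda>x. x) =
       (1 - c)\<^sup>2 * (1 - 2 * c)\<^sup>2 /
       (4 * (1 + 2 * c - 2 * c\<^sup>2)\<^sup>2 * (3 + 6 * c - 8 * c\<^sup>2 + 4 * c ^ 3 - 2 * c ^ 4))"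
proof -
  obtain \<mu> where sol: "finite_mean_solution c \<mu>" and supp: "AE x in \<mu>. 0 \<le> x \<and> x \<le> 1 / (2 * c)"
    using finite_mean_solution_exists[OF assms] by blast
  interpret solution c \<mu> using assms sol by unfold_locales
  have int2: "integrable \<mu> (\<lambda>x. x\<^sup>2)" by (rule integrable_bounded_support[OF supp])
  have conv: "weak_conv_m (\<lambda>k. normalized_err_inversions (n k) (p k)) \<mu>"
    if "filterlim n at_top sequentially" "\<forall>k. 0 < p k \<and> p k \<le> 1" "p \<longlonglongrightarrow> c" for n :: "nat \<Rightarrow> nat" and p :: "nat \<Rightarrow> real"
    by (rule levy_continuity[OF real_distribution_normalized_err_inversions real_distribution_axioms
          char_normalized_tendsto[OF that(1) spec[OF that(2)] that(3)]])
  show ?thesis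
  proof (intro exI[of _ \<mu>] conjI allI impI)
    show "\<nu> = \<mu>" if "finite_mean_solution c \<nu>" for \<nu>
      using finite_mean_solution_unique[OF _ _ that sol] assms by simp
    show "prob_space.expectation \<mu> (\<lambda>x. x) = (2 - c) / (2 * (1 + 2 * c - 2 * c\<^sup>2))"
      by (rule finite_mean_solution_expectation[OF assms sol])
    show "prob_space.variance \<mu> (\<lambda>x. x) =
       (1 - c)\<^sup>2 * (1 - 2 * c)\<^sup>2 /
       (4 * (1 + 2 * c - 2 * c\<^sup>2)\<^sup>2 * (3 + 6 * c - 8 * c\<^sup>2 + 4 * c ^ 3 - 2 * c ^ 4))"
      by (rule finite_mean_solution_variance[OF assms sol int2])
  qed (fact sol conv int2)+
qed

end
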